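(* Let $(\mathbf{X},d)$ be a complete length space, let $\Omega\subsetneq\mathbf{X}$ be a bounded domain, and let $(\overline{\Omega},d,\mu)$ be a complete bounded metric measure space with $\mu$ a doubling measure with homogeneous dimension $Q>0$. Let $f$ be a positive Borel measurable function on $\overline\Omega$. Assume that $\overline{\Omega}$ satisfies a $p$-Poincaré inequality for some finite $p>\max\{1,Q\}$ and that $f\in L^p(\overline{\Omega})$. Then for any distinct $x,y\in\overline{\Omega}$ there exists an admissible curve $\gamma\in\Gamma_f(x,y)$; in particular $\Gamma_f(x,y)\ne\emptyset$ for all $x,y\in\overline\Omega$. Furthermore, there exists a constant $C_f>0$ such that $$L_f(x,y)\le C_f\,d(x,y)^{1-\frac{Q}{p}}\quad\text{for all }x,y\in\overline{\Omega},$$ which implies that $\sup\{L_f(x,y):x,y\in\overline\Omega,\ d(x,y)\le r\}\to0$ as $r\to0$.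
   Context: Doubling: $\mu$ is a locally finite Borel measure, balls have positive finite measure, and there is $C_d\ge1$ with $\mu(B_{2r}(x))\le C_d\,\mu(B_r(x))$ for all $x$ and $r>0$. $Q=\log_2 C_d$ is called the homogeneous dimension; one has $\mu(B_r(x))/\mu(B_R(x))\ge C(r/R)^Q$ for all balls $B_r(x)\subset B_R(x)$. A Borel function $\rho$ with values in $[0,\infty]$ is an upper gradient of $w$ if $|w(\gamma(a))-w(\gamma(b))|\le\int_\gamma\rho\,ds$ for every rectifiable curve $\gamma:[a,b]\to\overline\Omega$. $(\overline{\Omega},d,\mu)$ supports a $p$-Poincaré inequality if there are $C>0$, $\lambda\ge1$ such that for every measurable $w$, every upper gradient $\rho$ of $w$ and every ball $B$, $\frac{1}{\mu(B)}\int_B|w-w_B|\,d\mu\le C\,\mathrm{diam}(B)\big(\frac{1}{\mu(\lambda B)}\int_{\lambda B}\rho^p\,d\mu\big)^{1/p}$, where $w_B$ is the mean of $w$ over $B$ and $\lambda B$ is the ball with the same center and $\lambda$ times the radius. For $x,y\in\overline{\Omega}$, $\Gamma_f(x,y)$ is the set of rectifiable curves $\gamma:[0,\ell]\to\overline{\Omega}$, parametrized by arc length, with $\gamma(0)=x$, $\gamma(\ell)=y$ and $\int_\gamma f\,ds<\infty$ (the constant curve is allowed when $x=y$), and $L_f(x,y):=\inf\{\int_\gamma f\,ds:\gamma\in\Gamma_f(x,y)\}$. Here $f$ is a fixed everywhere-defined function, not an a.e.-equivalence class. *)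

theory Defs
  imports "HOL-Analysis.Analysis"
begin

section \<open>Curves in metric spaces\<close>

definition curve_length :: "real \<Rightarrow> real \<Rightarrow> (real \<Rightarrow> 'a::metric_space) \<Rightarrow> ennreal" where
  "curve_length a b \<gamma> =
     (SUP (n, t) \<in> {(n::nat, t::nat \<Rightarrow> real). mono_on {..n} t \<and> t ` {..n} \<subseteq> {a..b}}.
        \<Sum>i<n. ennreal (dist (\<gamma> (t i)) (\<gamma> (t (Suc i)))))"

definition rectifiable_curve ::
    "'a::metric_space set \<Rightarrow> real \<Rightarrow> real \<Rightarrow> (real \<Rightarrow> 'a) \<Rightarrow> bool" where
  "rectifiable_curve S a b \<gamma> \<longleftrightarrow>
     a \<le> b \<and> continuous_on {a..b} \<gamma> \<and> \<gamma> ` {a..b} \<subseteq> S \<and> curve_length a b \<gamma> < \<infinity>"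

definition length_space :: "'a::metric_space set \<Rightarrow> bool" where
  "length_space S \<longleftrightarrow>
     (\<forall>x\<in>S. \<forall>y\<in>S. ennreal (dist x y) =
        Inf {curve_length a b \<gamma> | a b \<gamma>. rectifiable_curve S a b \<gamma> \<and> \<gamma> a = x \<and> \<gamma> b = y})"

text \<open>For a rectifiable curve on \<open>[a, b]\<close> and \<open>0 \<le> s \<le> length\<close>, the value at \<open>s\<close> is \<open>\<gamma> t\<close> for
  some \<open>t\<close> such that \<open>\<gamma>\<close> restricted to \<open>[a, t]\<close> has length \<open>s\<close>. Such a \<open>t\<close> exists, and \<open>\<gamma> t\<close>
  does not depend on the choice, because \<open>\<gamma>\<close> is constant between any two such parameters.\<close>

definition arc_length_reparam ::
    "real \<Rightarrow> real \<Rightarrow> (real \<Rightarrow> 'a::metric_space) \<Rightarrow> real \<Rightarrow> 'a" where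
  "arc_length_reparam a b \<gamma> s = \<gamma> (SOME t. t \<in> {a..b} \<and> curve_length a t \<gamma> = ennreal s)"

definition line_integral ::
    "real \<Rightarrow> real \<Rightarrow> (real \<Rightarrow> 'a::metric_space) \<Rightarrow> ('a \<Rightarrow> ennreal) \<Rightarrow> ennreal" where
  "line_integral a b \<gamma> \<rho> =
     (\<integral>\<^sup>+ s \<in> {0..enn2real (curve_length a b \<gamma>)}. \<rho> (arc_length_reparam a b \<gamma> s) \<partial>lborel)"

definition arc_length_parametrized :: "real \<Rightarrow> (real \<Rightarrow> 'a::metric_space) \<Rightarrow> bool" where
  "arc_length_parametrized l \<gamma> \<longleftrightarrow> (\<forall>t\<in>{0..l}. curve_length 0 t \<gamma> = ennreal t)"


section \<open>Doubling measures and Poincare inequalities\<close>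

text \<open>Balls of the metric space \<open>S\<close> (with the restricted metric) are open balls intersected with
  \<open>S\<close>. They are always given by a center and a radius, as in general a ball, viewed as a set, does
  not determine them.\<close>

abbreviation rel_ball :: "'a::metric_space set \<Rightarrow> 'a \<Rightarrow> real \<Rightarrow> 'a set" where
  "rel_ball S x r \<equiv> ball x r \<inter> S"

text \<open>Local finiteness of \<open>\<mu>\<close> is part of the requirement that balls have finite measure.\<close>

definition doubling_measure :: "'a::metric_space set \<Rightarrow> 'a measure \<Rightarrow> real \<Rightarrow> bool" where
  "doubling_measure S \<mu> C\<^sub>d \<longleftrightarrow>
     sets \<mu> = sets (restrict_space borel S) \<and>
     (\<forall>x\<in>S. \<forall>r>0. 0 < emeasure \<mu> (rel_ball S x r) \<and> emeasure \<mu> (rel_ball S x r) < \<infinity>) \<and>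
     C\<^sub>d \<ge> 1 \<and>
     (\<forall>x\<in>S. \<forall>r>0. emeasure \<mu> (rel_ball S x (2 * r)) \<le> ennreal C\<^sub>d * emeasure \<mu> (rel_ball S x r))"

definition homogeneous_dimension :: "real \<Rightarrow> real" where
  "homogeneous_dimension C\<^sub>d = log 2 C\<^sub>d"

definition upper_gradient ::
    "'a::metric_space set \<Rightarrow> ('a \<Rightarrow> real) \<Rightarrow> ('a \<Rightarrow> ennreal) \<Rightarrow> bool" where
  "upper_gradient S w \<rho> \<longleftrightarrow>
     \<rho> \<in> borel_measurable (restrict_space borel S) \<and>
     (\<forall>a b \<gamma>. rectifiable_curve S a b \<gamma> \<longrightarrow>
        ennreal \<bar>w (\<gamma> a) - w (\<gamma> b)\<bar> \<le> line_integral a b \<gamma> \<rho>)"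

text \<open>Real powers on \<open>[0, \<infinity>]\<close>, for exponents \<open>p > 0\<close>.\<close>

definition ennreal_powr :: "ennreal \<Rightarrow> real \<Rightarrow> ennreal" where
  "ennreal_powr a p = (if a = \<infinity> then \<infinity> else ennreal (enn2real a powr p))"

definition mean_value :: "'a measure \<Rightarrow> 'a set \<Rightarrow> ('a \<Rightarrow> real) \<Rightarrow> real" where
  "mean_value \<mu> B w = (LINT z:B|\<mu>. w z) / measure \<mu> B"

text \<open>The inequality is required on a ball \<open>B\<close> only for those measurable \<open>w\<close> that are integrable
  on \<open>B\<close>, since otherwise the mean of \<open>w\<close> over \<open>B\<close> is not defined. The right-hand side is
  \<open>\<infinity>\<close> if \<open>\<rho>\<^sup>p\<close> is not integrable (and \<open>diameter B > 0\<close>).\<close>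

definition poincare_inequality :: "'a::metric_space set \<Rightarrow> 'a measure \<Rightarrow> real \<Rightarrow> bool" where
  "poincare_inequality S \<mu> p \<longleftrightarrow>
     (\<exists>C>0. \<exists>\<Lambda>\<ge>1. \<forall>w \<rho>. w \<in> borel_measurable \<mu> \<longrightarrow> upper_gradient S w \<rho> \<longrightarrow>
       (\<forall>x\<in>S. \<forall>r>0. set_integrable \<mu> (rel_ball S x r) w \<longrightarrow>
          (\<integral>\<^sup>+ z \<in> rel_ball S x r.
              ennreal \<bar>w z - mean_value \<mu> (rel_ball S x r) w\<bar> \<partial>\<mu>)
            / emeasure \<mu> (rel_ball S x r)
          \<le> ennreal (C * diameter (rel_ball S x r)) *
             ennreal_powr
               ((\<integral>\<^sup>+ z \<in> rel_ball S x (\<Lambda> * r). ennreal_powr (\<rho> z) p \<partial>\<mu>)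
                  / emeasure \<mu> (rel_ball S x (\<Lambda> * r)))
               (1 / p)))"


section \<open>Admissible curves and the optimal cost\<close>

text \<open>A curve \<open>\<gamma> : [0, l] \<rightarrow> S\<close> is represented by the pair \<open>(l, \<gamma>)\<close>; the values of \<open>\<gamma>\<close> outside
  \<open>[0, l]\<close> are irrelevant. For \<open>x = y\<close> the constant curve is the case \<open>l = 0\<close>.\<close>

definition admissible_curves ::
    "'a::metric_space set \<Rightarrow> ('a \<Rightarrow> real) \<Rightarrow> 'a \<Rightarrow> 'a \<Rightarrow> (real \<times> (real \<Rightarrow> 'a)) set" where
  "admissible_curves S f x y =
     {(l, \<gamma>). rectifiable_curve S 0 l \<gamma> \<and> arc_length_parametrized l \<gamma> \<and>
              \<gamma> 0 = x \<and> \<gamma> l = y \<and> line_integral 0 l \<gamma> (\<lambda>z. ennreal (f z)) < \<infinity>}"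

definition L_dist :: "'a::metric_space set \<Rightarrow> ('a \<Rightarrow> real) \<Rightarrow> 'a \<Rightarrow> 'a \<Rightarrow> ennreal" where
  "L_dist S f x y =
     (INF (l, \<gamma>) \<in> admissible_curves S f x y. line_integral 0 l \<gamma> (\<lambda>z. ennreal (f z)))"

end

theory Submission
  imports Defs
begin

text \<open>
  Morrey's inequality bounds a function \<open>w\<close> with upper gradient \<open>\<rho>\<close> in \<open>L\<^sup>p\<close>, \<open>p > Q\<close>, by
  \<open>\<bar>w x - w y\<bar> \<le> K d(x, y)\<^bsup>1 - Q/p\<^esup>\<close>, where \<open>K\<close> depends on \<open>\<rho>\<close> only through its \<open>L\<^sup>p\<close>-norm
  (\<open>poincare_imp_hoelder\<close>): telescope the means of \<open>w\<close> over balls shrinking to \<open>x\<close> and to \<open>y\<close>, and use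
  the lower mass bound for a doubling measure. One would like to apply this to \<open>w y = L_dist S f x y\<close>, which
  has upper gradient \<open>f\<close>. But that function need not be finite, which is part of the claim, and its
  measurability is a delicate question. The proof therefore works with discrete approximations, for which
  both are obvious, and passes to the limit only once.

  The function \<open>f\<close> is majorized by the supremum of an increasing sequence of Lipschitz functions
  \<open>g n \<ge> 1\<close> with bounded \<open>L\<^sup>p\<close>-norms (\<open>lipschitz_sequence_above_powr\<close>, the Vitali-Caratheodory theorem).
  For each \<open>n\<close>, let \<open>w y\<close> be the infimum of the sums \<open>\<Sum>i. g n (c i) * dist (c i) (c (Suc i))\<close> over all
  chains \<open>c\<close> from \<open>x\<close> to \<open>y\<close> with steps of length at most \<open>\<epsilon> n\<close>. Connectedness of the space makes it
  finite. It is continuous, and \<open>g n\<close> is an upper gradient of it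
  (\<open>upper_gradient_of_small_scale_growth\<close>), since adding a short step to a chain changes the sum by the
  corresponding amount. Hence for each \<open>n\<close> there is a chain from \<open>x\<close> to \<open>y\<close> of cost at most
  \<open>T = 2 K d(x, y)\<^bsup>1 - Q/p\<^esup>\<close>.

  Parametrized by cost, these chains become step functions on \<open>[0, T]\<close>. The space is compact, as it is
  complete, bounded and carries a doubling measure, so the step functions have a pointwise cluster point
  \<open>\<gamma>\<close> (\<open>slow_curve_of_chains\<close>). It is a 1-Lipschitz curve from \<open>x\<close> to \<open>y\<close> that needs at least
  \<open>g m\<close> units of time per unit of length, for every \<open>m\<close>. So after reparametrization by arc length, the
  integral of each \<open>g m\<close> along it, and by monotone convergence that of \<open>f\<close>, is at most \<open>T\<close>
  (\<open>admissible_curve_of_slow_curve\<close>).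
\<close>

section \<open>Length of curves and arc length\<close>

lemma dist_sum_le_curve_length:
  fixes \<gamma> :: "real \<Rightarrow> 'a::metric_space"
  assumes "mono_on {..n} t" "t ` {..n} \<subseteq> {a..b}"
  shows "(\<Sum>i<n. ennreal (dist (\<gamma> (t i)) (\<gamma> (t (Suc i))))) \<le> curve_length a b \<gamma>"
  unfolding curve_length_def
  by (rule SUP_upper2[where i = "(n, t)"]) (use assms in auto)

text \<open>The upper bounds on lengths below come from this telescoping estimate, applied to a
  function \<open>F\<close> that majorizes the distances along the curve.\<close>

lemma curve_length_le:
  fixes \<gamma> :: "real \<Rightarrow> 'a::metric_space"
  assumes F: "\<And>s t. a \<le> s \<Longrightarrow> s \<le> t \<Longrightarrow> t \<le> b \<Longrightarrow> dist (\<gamma> s) (\<gamma> t) \<le> F t - F s"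
    and "a \<le> b"
  shows "curve_length a b \<gamma> \<le> ennreal (F b - F a)"
  unfolding curve_length_def
proof (rule SUP_least, clarify)
  fix n and t :: "nat \<Rightarrow> real"
  assume t: "mono_on {..n} t" "t ` {..n} \<subseteq> {a..b}"
  have tab: "t i \<in> {a..b}" if "i \<le> n" for i using t(2) that by auto
  have mono: "t i \<le> t j" if "i \<le> j" "j \<le> n" for i j
    using t(1) that by (auto simp: mono_on_def)
  have mF: "F s \<le> F u" if "a \<le> s" "s \<le> u" "u \<le> b" for s u
    using F[OF that] zero_le_dist[of "\<gamma> s" "\<gamma> u"] by linarith
  have "(\<Sum>i<n. dist (\<gamma> (t i)) (\<gamma> (t (Suc i)))) \<le> (\<Sum>i<n. F (t (Suc i)) - F (t i))"
    by (rule sum_mono, rule F) (use tab mono in force)+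
  also have "\<dots> = F (t n) - F (t 0)" by (rule sum_lessThan_telescope)
  also have "\<dots> \<le> F b - F a"
    using mF[of "t n" b] mF[of a "t 0"] tab[of n] tab[of 0] by auto
  finally show "(\<Sum>i<n. ennreal (dist (\<gamma> (t i)) (\<gamma> (t (Suc i))))) \<le> ennreal (F b - F a)"
    by (simp add: sum_ennreal ennreal_leI)
qed

lemma curve_length_mono:
  "b \<le> c \<Longrightarrow> curve_length a b \<gamma> \<le> curve_length a c \<gamma>"
  unfolding curve_length_def by (rule SUP_subset_mono) fastforce+

lemma curve_length_add_dist_le:
  fixes \<gamma> :: "real \<Rightarrow> 'a::metric_space"
  assumes "a \<le> s" "s \<le> t"
  shows "curve_length a s \<gamma> + ennreal (dist (\<gamma> s) (\<gamma> t)) \<le> curve_length a t \<gamma>"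
proof -
  let ?I = "{(n::nat, u::nat \<Rightarrow> real). mono_on {..n} u \<and> u ` {..n} \<subseteq> {a..s}}"
  have ne: "?I \<noteq> {}" using assms by (auto intro!: exI[of _ 0] exI[of _ "\<lambda>_. a"] simp: mono_on_def)
  have "curve_length a s \<gamma> + ennreal (dist (\<gamma> s) (\<gamma> t)) =
      (SUP (n, u) \<in> ?I. (\<Sum>i<n. ennreal (dist (\<gamma> (u i)) (\<gamma> (u (Suc i))))) + ennreal (dist (\<gamma> s) (\<gamma> t)))"
    unfolding curve_length_def
    by (subst ennreal_SUP_add_left[OF ne, symmetric]) (auto simp: case_prod_unfold)
  also have "\<dots> \<le> curve_length a t \<gamma>"
  proof (rule SUP_least, clarify)
    fix n and u :: "nat \<Rightarrow> real"
    assume u: "mono_on {..n} u" "u ` {..n} \<subseteq> {a..s}"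
    define v where "v i = (if i \<le> n then u i else if i = Suc n then s else t)" for i
    have us: "u i \<in> {a..s}" if "i \<le> n" for i using u(2) that by auto
    have mv: "mono_on {..Suc (Suc n)} v"
      unfolding mono_on_def v_def using u(1) us assms
      by (auto simp: mono_on_def not_le) (meson order.trans)+
    have rv: "v ` {..Suc (Suc n)} \<subseteq> {a..t}"
      unfolding v_def using us assms by (force simp: )
    have "(\<Sum>i<n. ennreal (dist (\<gamma> (u i)) (\<gamma> (u (Suc i))))) = (\<Sum>i<n. ennreal (dist (\<gamma> (v i)) (\<gamma> (v (Suc i)))))"
      by (rule sum.cong) (auto simp: v_def)
    then have "(\<Sum>i<n. ennreal (dist (\<gamma> (u i)) (\<gamma> (u (Suc i))))) + ennreal (dist (\<gamma> s) (\<gamma> t))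
        \<le> (\<Sum>i<Suc (Suc n). ennreal (dist (\<gamma> (v i)) (\<gamma> (v (Suc i)))))"
      by (simp add: v_def add.assoc add_left_mono)
    also have "\<dots> \<le> curve_length a t \<gamma>"
      by (rule dist_sum_le_curve_length[OF mv rv])
    finally show "(\<Sum>i<n. ennreal (dist (\<gamma> (u i)) (\<gamma> (u (Suc i))))) + ennreal (dist (\<gamma> s) (\<gamma> t))
        \<le> curve_length a t \<gamma>" .
  qed
  finally show ?thesis .
qed

definition length_upto :: "real \<Rightarrow> (real \<Rightarrow> 'a::metric_space) \<Rightarrow> real \<Rightarrow> real" where
  "length_upto a \<gamma> t = enn2real (curve_length a t \<gamma>)"

context
  fixes S :: "'a::metric_space set" and a b :: real and \<gamma> :: "real \<Rightarrow> 'a"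
  assumes rect: "rectifiable_curve S a b \<gamma>"
begin

lemma curve_length_eq_length_upto:
  "t \<le> b \<Longrightarrow> curve_length a t \<gamma> = ennreal (length_upto a \<gamma> t)"
  using rect curve_length_mono[of t b a \<gamma>]
  by (auto simp: rectifiable_curve_def length_upto_def)

lemma dist_le_length_upto_diff:
  assumes "a \<le> s" "s \<le> t" "t \<le> b"
  shows "dist (\<gamma> s) (\<gamma> t) \<le> length_upto a \<gamma> t - length_upto a \<gamma> s"
proof -
  have nn: "length_upto a \<gamma> s \<ge> 0" by (simp add: length_upto_def)
  show ?thesis
    using curve_length_add_dist_le[OF assms(1,2), of \<gamma>] assms nn
    by (simp add: curve_length_eq_length_upto flip: ennreal_plus)
       (subst (asm) ennreal_le_iff; simp add: length_upto_def)
qed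

lemma length_upto_mono:
  assumes "a \<le> s" "s \<le> t" "t \<le> b"
  shows "length_upto a \<gamma> s \<le> length_upto a \<gamma> t"
  using dist_le_length_upto_diff[OF assms] zero_le_dist[of "\<gamma> s" "\<gamma> t"] by linarith

lemma length_upto_start: "length_upto a \<gamma> a = 0"
proof -
  have "curve_length a a \<gamma> \<le> ennreal (0 - 0)"
  proof (rule curve_length_le)
    fix s t assume "a \<le> s" "s \<le> t" "t \<le> a"
    then have "s = t" by linarith
    then show "dist (\<gamma> s) (\<gamma> t) \<le> 0 - 0" by simp
  qed simp
  then show ?thesis by (simp add: length_upto_def)
qed

text \<open>Extending \<open>F\<close> by the length function itself on \<open>[a, s]\<close> gives a majorant of the distances on
  \<open>[a, t]\<close>, so the telescoping estimate applies to the whole of \<open>[a, t]\<close>.\<close>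

lemma length_upto_diff_le:
  assumes st: "a \<le> s" "s \<le> t" "t \<le> b"
    and F: "\<And>u v. s \<le> u \<Longrightarrow> u \<le> v \<Longrightarrow> v \<le> t \<Longrightarrow> dist (\<gamma> u) (\<gamma> v) \<le> F v - F u"
  shows "length_upto a \<gamma> t - length_upto a \<gamma> s \<le> F t - F s"
proof -
  define G where "G u = (if u \<le> s then length_upto a \<gamma> u else length_upto a \<gamma> s + F u - F s)" for u
  have "dist (\<gamma> u) (\<gamma> v) \<le> G v - G u" if uv: "a \<le> u" "u \<le> v" "v \<le> t" for u v
  proof -
    consider "v \<le> s" | "s < u" | "u \<le> s" "s < v" by linarith
    then show ?thesis
    proof cases
      case 1 then show ?thesis using dist_le_length_upto_diff uv st by (auto simp: G_def)
    next
      case 2 then show ?thesis using F uv by (auto simp: G_def)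
    next
      case 3
      have "dist (\<gamma> u) (\<gamma> v) \<le> dist (\<gamma> u) (\<gamma> s) + dist (\<gamma> s) (\<gamma> v)" by (rule dist_triangle)
      also have "\<dots> \<le> (length_upto a \<gamma> s - length_upto a \<gamma> u) + (F v - F s)"
        using dist_le_length_upto_diff[of u s] F[of s v] 3 uv st by (intro add_mono) auto
      finally show ?thesis using 3 by (auto simp: G_def)
    qed
  qed
  then have "curve_length a t \<gamma> \<le> ennreal (G t - G a)"
    by (rule curve_length_le) (use st in auto)
  moreover have "G a = 0" using st length_upto_start by (simp add: G_def)
  moreover have "G t \<ge> 0"
  proof -
    have "0 \<le> dist (\<gamma> s) (\<gamma> t)" by simp
    also have "\<dots> \<le> F t - F s" using F st by auto
    finally have "F s \<le> F t" by simp
    moreover have "0 \<le> length_upto a \<gamma> t" "0 \<le> length_upto a \<gamma> s" by (simp_all add: length_upto_def)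
    ultimately show ?thesis by (auto simp: G_def)
  qed
  ultimately have "length_upto a \<gamma> t \<le> G t"
    unfolding length_upto_def by (intro enn2real_leI) auto
  moreover have "G t = length_upto a \<gamma> s + F t - F s"
    using st by (auto simp: G_def)
  ultimately show ?thesis by linarith
qed

text \<open>A jump of size \<open>\<rho>\<close> of the length function cannot occur where \<open>\<gamma>\<close> moves by less than
  \<open>\<rho>/2\<close>: lowering the length function by \<open>\<rho>/2\<close> past the jump would still majorize the
  distances, so the length would be smaller by \<open>\<rho>/2\<close> than it is.\<close>

lemma length_upto_no_jump_right:
  assumes u: "a \<le> u" "u < b" and "\<rho> > 0"
  shows "\<exists>t>u. t \<le> b \<and> length_upto a \<gamma> t - length_upto a \<gamma> u < \<rho>"
proof (rule ccontr)
  assume "\<not> ?thesis"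
  then have jump: "length_upto a \<gamma> t - length_upto a \<gamma> u \<ge> \<rho>" if "u < t" "t \<le> b" for t
    using that by force
  have "continuous_on {a..b} \<gamma>" using rect by (simp add: rectifiable_curve_def)
  then obtain d where d: "d > 0" "\<And>s. s \<in> {a..b} \<Longrightarrow> dist s u < d \<Longrightarrow> dist (\<gamma> s) (\<gamma> u) < \<rho> / 2"
    using u \<open>\<rho> > 0\<close> unfolding continuous_on_iff
    by (metis atLeastAtMost_iff half_gt_zero less_eq_real_def)
  define t where "t = min b (u + d / 2)"
  have t: "u < t" "t \<le> b" "t - u < d" using u d by (auto simp: t_def)
  define F where "F v = (if v \<le> u then length_upto a \<gamma> u else length_upto a \<gamma> v - \<rho> / 2)" for v
  have "length_upto a \<gamma> t - length_upto a \<gamma> u \<le> F t - F u"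
  proof (rule length_upto_diff_le)
    fix v v' assume v: "u \<le> v" "v \<le> v'" "v' \<le> t"
    show "dist (\<gamma> v) (\<gamma> v') \<le> F v' - F v"
    proof (cases "v = u")
      case True
      show ?thesis
      proof (cases "v' = u")
        case False
        then have "dist (\<gamma> v') (\<gamma> u) < \<rho> / 2" "length_upto a \<gamma> v' - length_upto a \<gamma> u \<ge> \<rho>"
          using d(2)[of v'] jump[of v'] v t u by (auto simp: dist_real_def)
        then show ?thesis using True False v by (auto simp: F_def dist_commute)
      qed (use True in auto)
    next
      case False
      then show ?thesis using dist_le_length_upto_diff[of v v'] v t u by (auto simp: F_def)
    qed
  qed (use u t in auto)
  then show False using t \<open>\<rho> > 0\<close> by (auto simp: F_def)
qed

lemma length_upto_no_jump_left:
  assumes u: "a < u" "u \<le> b" and "\<rho> > 0"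
  shows "\<exists>t<u. a \<le> t \<and> length_upto a \<gamma> u - length_upto a \<gamma> t < \<rho>"
proof (rule ccontr)
  assume "\<not> ?thesis"
  then have jump: "length_upto a \<gamma> u - length_upto a \<gamma> t \<ge> \<rho>" if "t < u" "a \<le> t" for t
    using that by force
  have "continuous_on {a..b} \<gamma>" using rect by (simp add: rectifiable_curve_def)
  then obtain d where d: "d > 0" "\<And>s. s \<in> {a..b} \<Longrightarrow> dist s u < d \<Longrightarrow> dist (\<gamma> s) (\<gamma> u) < \<rho> / 2"
    using u \<open>\<rho> > 0\<close> unfolding continuous_on_iff
    by (metis atLeastAtMost_iff half_gt_zero less_eq_real_def)
  define t where "t = max a (u - d / 2)"
  have t: "t < u" "a \<le> t" "u - t < d" using u d by (auto simp: t_def)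
  define F where "F v = (if v < u then length_upto a \<gamma> v else length_upto a \<gamma> u - \<rho> / 2)" for v
  have "length_upto a \<gamma> u - length_upto a \<gamma> t \<le> F u - F t"
  proof (rule length_upto_diff_le)
    fix v v' assume v: "t \<le> v" "v \<le> v'" "v' \<le> u"
    show "dist (\<gamma> v) (\<gamma> v') \<le> F v' - F v"
    proof (cases "v' = u")
      case True
      show ?thesis
      proof (cases "v = u")
        case False
        then have "dist (\<gamma> v) (\<gamma> u) < \<rho> / 2" "length_upto a \<gamma> u - length_upto a \<gamma> v \<ge> \<rho>"
          using d(2)[of v] jump[of v] v t u by (auto simp: dist_real_def)
        then show ?thesis using True False v by (auto simp: F_def)
      qed (use True in auto)
    next
      case False
      then show ?thesis using dist_le_length_upto_diff[of v v'] v t u by (auto simp: F_def)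
    qed
  qed (use u t in auto)
  then show False using t \<open>\<rho> > 0\<close> by (auto simp: F_def)
qed

text \<open>Continuity of the length function is what makes the arc length parametrization well defined
  on all of \<open>[0, length]\<close>.\<close>

lemma continuous_on_length_upto: "continuous_on {a..b} (length_upto a \<gamma>)"
  unfolding continuous_on_iff
proof (intro ballI allI impI)
  fix u e :: real assume u: "u \<in> {a..b}" and e: "e > 0"
  obtain r where r: "r > u" "\<And>t. t \<in> {a..b} \<Longrightarrow> u \<le> t \<Longrightarrow> t < r \<Longrightarrow> length_upto a \<gamma> t - length_upto a \<gamma> u < e"
  proof (cases "u < b")
    case True
    then obtain t where t: "t > u" "t \<le> b" "length_upto a \<gamma> t - length_upto a \<gamma> u < e"
      using length_upto_no_jump_right[of u e] u e by auto
    have "length_upto a \<gamma> v - length_upto a \<gamma> u < e" if "v \<in> {a..b}" "u \<le> v" "v < t" for v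
      using length_upto_mono[of v t] t that by auto
    then show ?thesis by (rule that[OF t(1)])
  next
    case False
    then show ?thesis using e u by (intro that[of "u + 1"]) auto
  qed
  obtain l where l: "l < u" "\<And>t. t \<in> {a..b} \<Longrightarrow> t \<le> u \<Longrightarrow> l < t \<Longrightarrow> length_upto a \<gamma> u - length_upto a \<gamma> t < e"
  proof (cases "a < u")
    case True
    then obtain t where t: "t < u" "a \<le> t" "length_upto a \<gamma> u - length_upto a \<gamma> t < e"
      using length_upto_no_jump_left[of u e] u e by auto
    have "length_upto a \<gamma> u - length_upto a \<gamma> v < e" if "v \<in> {a..b}" "v \<le> u" "t < v" for v
      using length_upto_mono[of t v] t that by auto
    then show ?thesis by (rule that[OF t(1)])
  next
    case False
    then show ?thesis using e u by (intro that[of "u - 1"]) auto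
  qed
  show "\<exists>d>0. \<forall>t\<in>{a..b}. dist t u < d \<longrightarrow> dist (length_upto a \<gamma> t) (length_upto a \<gamma> u) < e"
  proof (intro exI[of _ "min (r - u) (u - l)"] conjI ballI impI)
    fix t assume t: "t \<in> {a..b}" "dist t u < min (r - u) (u - l)"
    show "dist (length_upto a \<gamma> t) (length_upto a \<gamma> u) < e"
    proof (cases "u \<le> t")
      case True
      then show ?thesis using r(2)[of t] t u length_upto_mono[of u t] by (auto simp: dist_real_def)
    next
      case False
      then show ?thesis using l(2)[of t] t u length_upto_mono[of t u] by (auto simp: dist_real_def)
    qed
  qed (use r l in auto)
qed

lemma ex_length_upto_eq:
  assumes "0 \<le> s" "s \<le> length_upto a \<gamma> b"
  shows "\<exists>t. t \<in> {a..b} \<and> length_upto a \<gamma> t = s"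
  using IVT'[of "length_upto a \<gamma>" a s b] assms length_upto_start continuous_on_length_upto rect
  by (auto simp: rectifiable_curve_def)

lemma arc_length_reparam_length_upto:
  assumes t: "t \<in> {a..b}"
  shows "arc_length_reparam a b \<gamma> (length_upto a \<gamma> t) = \<gamma> t"
proof -
  define u where "u = (SOME u. u \<in> {a..b} \<and> curve_length a u \<gamma> = ennreal (length_upto a \<gamma> t))"
  have "u \<in> {a..b} \<and> curve_length a u \<gamma> = ennreal (length_upto a \<gamma> t)"
    unfolding u_def by (rule someI[of _ t]) (use t curve_length_eq_length_upto in auto)
  then have u: "u \<in> {a..b}" "length_upto a \<gamma> u = length_upto a \<gamma> t"
    by (auto simp: length_upto_def)
  have "dist (\<gamma> u) (\<gamma> t) \<le> 0"
  proof (cases "u \<le> t")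
    case True
    then show ?thesis using dist_le_length_upto_diff[of u t] u t by simp
  next
    case False
    then show ?thesis using dist_le_length_upto_diff[of t u] u t by (simp add: dist_commute)
  qed
  then show ?thesis unfolding arc_length_reparam_def u_def[symmetric] by simp
qed

lemma arc_length_reparam_dist_le:
  assumes "0 \<le> s" "s \<le> t" "t \<le> length_upto a \<gamma> b"
  shows "dist (arc_length_reparam a b \<gamma> s) (arc_length_reparam a b \<gamma> t) \<le> t - s"
proof -
  obtain u v where u: "u \<in> {a..b}" "length_upto a \<gamma> u = s" and v: "v \<in> {a..b}" "length_upto a \<gamma> v = t"
    using ex_length_upto_eq[of s] ex_length_upto_eq[of t] assms by auto
  have eq: "arc_length_reparam a b \<gamma> s = \<gamma> u" "arc_length_reparam a b \<gamma> t = \<gamma> v"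
    using arc_length_reparam_length_upto u v by auto
  show ?thesis
  proof (cases "u \<le> v")
    case True
    then show ?thesis unfolding eq using dist_le_length_upto_diff[of u v] u v by auto
  next
    case False
    then have "length_upto a \<gamma> v \<le> length_upto a \<gamma> u" "dist (\<gamma> u) (\<gamma> v) \<le> length_upto a \<gamma> u - length_upto a \<gamma> v"
      using dist_le_length_upto_diff[of v u] length_upto_mono[of v u] u v by (auto simp: dist_commute)
    then show ?thesis unfolding eq using u v assms by auto
  qed
qed

lemma arc_length_reparam_in:
  assumes "s \<in> {0..length_upto a \<gamma> b}"
  shows "arc_length_reparam a b \<gamma> s \<in> S"
proof -
  obtain u where u: "u \<in> {a..b}" "length_upto a \<gamma> u = s" using ex_length_upto_eq[of s] assms by auto
  then show ?thesis using arc_length_reparam_length_upto[of u] rect by (auto simp: rectifiable_curve_def)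
qed

text \<open>The reparametrization is 1-Lipschitz, which bounds its length from above; conversely the length
  function carries every partition for \<open>\<gamma>\<close> to a partition for the reparametrization with the same
  points on the curve.\<close>

lemma curve_length_arc_length_reparam:
  assumes s: "s \<in> {0..length_upto a \<gamma> b}"
  shows "curve_length 0 s (arc_length_reparam a b \<gamma>) = ennreal s"
proof (rule antisym)
  have "curve_length 0 s (arc_length_reparam a b \<gamma>) \<le> ennreal (s - 0)"
    by (rule curve_length_le) (use arc_length_reparam_dist_le s in auto)
  then show "curve_length 0 s (arc_length_reparam a b \<gamma>) \<le> ennreal s" by simp
next
  obtain u where u: "u \<in> {a..b}" "length_upto a \<gamma> u = s" using ex_length_upto_eq[of s] s by auto
  have "curve_length a u \<gamma> \<le> curve_length 0 s (arc_length_reparam a b \<gamma>)"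
    unfolding curve_length_def[of a]
  proof (rule SUP_least, clarify)
    fix n and t :: "nat \<Rightarrow> real"
    assume t: "mono_on {..n} t" "t ` {..n} \<subseteq> {a..u}"
    have tn: "t i \<in> {a..u}" if "i \<le> n" for i using t(2) that by auto
    define v where "v i = length_upto a \<gamma> (t i)" for i
    have mv: "mono_on {..n} v" unfolding mono_on_def v_def
    proof (intro allI impI)
      fix i j assume ij: "i \<in> {..n} \<and> j \<in> {..n} \<and> i \<le> j"
      then have "i \<le> n" "j \<le> n" "i \<le> j" by auto
      then show "length_upto a \<gamma> (t i) \<le> length_upto a \<gamma> (t j)"
        using tn[of i] tn[of j] t(1) u by (intro length_upto_mono) (auto simp: mono_on_def)
    qed
    have rv: "v ` {..n} \<subseteq> {0..s}"
    proof clarify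
      fix i assume "i \<le> n"
      then show "v i \<in> {0..s}"
        using tn[of i] u length_upto_mono[of "t i" u] by (auto simp: v_def length_upto_def)
    qed
    have "arc_length_reparam a b \<gamma> (v i) = \<gamma> (t i)" if "i \<le> n" for i
      unfolding v_def by (rule arc_length_reparam_length_upto) (use tn[OF that] u in auto)
    then have "(\<Sum>i<n. ennreal (dist (\<gamma> (t i)) (\<gamma> (t (Suc i))))) =
      (\<Sum>i<n. ennreal (dist (arc_length_reparam a b \<gamma> (v i)) (arc_length_reparam a b \<gamma> (v (Suc i)))))"
      by (intro sum.cong) auto
    also have "\<dots> \<le> curve_length 0 s (arc_length_reparam a b \<gamma>)"
      by (rule dist_sum_le_curve_length[OF mv rv])
    finally show "(\<Sum>i<n. ennreal (dist (\<gamma> (t i)) (\<gamma> (t (Suc i))))) \<le> curve_length 0 s (arc_length_reparam a b \<gamma>)" .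
  qed
  then show "ennreal s \<le> curve_length 0 s (arc_length_reparam a b \<gamma>)"
    using curve_length_eq_length_upto[of u] u by auto
qed

lemma rectifiable_arc_length_reparam:
  "rectifiable_curve S 0 (length_upto a \<gamma> b) (arc_length_reparam a b \<gamma>)"
  unfolding rectifiable_curve_def
proof (intro conjI)
  show "0 \<le> length_upto a \<gamma> b" by (simp add: length_upto_def)
  then show "curve_length 0 (length_upto a \<gamma> b) (arc_length_reparam a b \<gamma>) < \<infinity>"
    by (subst curve_length_arc_length_reparam) auto
  have "dist (arc_length_reparam a b \<gamma> s) (arc_length_reparam a b \<gamma> t) \<le> dist s t"
    if "s \<in> {0..length_upto a \<gamma> b}" "t \<in> {0..length_upto a \<gamma> b}" for s t
    using arc_length_reparam_dist_le[of s t] arc_length_reparam_dist_le[of t s] that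
    by (cases "s \<le> t") (auto simp: dist_real_def dist_commute)
  then show "continuous_on {0..length_upto a \<gamma> b} (arc_length_reparam a b \<gamma>)"
    unfolding continuous_on_iff by (meson le_less_trans)
  show "arc_length_reparam a b \<gamma> ` {0..length_upto a \<gamma> b} \<subseteq> S"
    using arc_length_reparam_in by auto
qed

end

lemma arc_length_reparam_of_parametrized:
  assumes "arc_length_parametrized l \<gamma>" "s \<in> {0..l}"
  shows "arc_length_reparam 0 l \<gamma> s = \<gamma> s"
proof -
  have "(SOME t. t \<in> {0..l} \<and> curve_length 0 t \<gamma> = ennreal s) = s"
    by (rule some_equality) (use assms in \<open>auto simp: arc_length_parametrized_def\<close>)
  then show ?thesis by (simp add: arc_length_reparam_def)
qed

section \<open>Integrals along curves\<close>

text \<open>The errors of \<open>k\<close> equal steps sum up to \<open>O(1/k)\<close>. This compares integrals along curves with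
  other increments in both directions: from below for upper gradients, and from above for the curve that
  is constructed at the end. The integrands compared in this way are Lipschitz functions of arc length,
  so that the errors are quadratic.\<close>

lemma le_of_quadratic_increments:
  fixes F :: "real \<Rightarrow> real"
  assumes "a \<le> b" "\<delta> > 0"
    and F: "\<And>s t. a \<le> s \<Longrightarrow> s \<le> t \<Longrightarrow> t \<le> b \<Longrightarrow> t - s < \<delta> \<Longrightarrow> F t - F s \<le> c * (t - s)\<^sup>2"
  shows "F b \<le> F a"
proof -
  have "(\<lambda>k. c * (b - a)\<^sup>2 / real k) \<longlonglongrightarrow> 0" by (rule lim_const_over_n)
  moreover have "\<forall>\<^sub>F k in sequentially. F b - F a \<le> c * (b - a)\<^sup>2 / real k"
  proof -
    have "(\<lambda>k. (b - a) / real k) \<longlonglongrightarrow> 0" by (rule lim_const_over_n)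
    then have "\<forall>\<^sub>F k in sequentially. (b - a) / real k < \<delta>"
      using \<open>\<delta> > 0\<close> by (auto dest: order_tendstoD)
    then show ?thesis using eventually_gt_at_top[of 0]
    proof eventually_elim
      case (elim k)
      define t where "t i = a + real i * ((b - a) / real k)" for i
      have t: "t 0 = a" "t k = b" "\<And>i. t (Suc i) - t i = (b - a) / real k"
        using elim by (auto simp: t_def field_simps)
      have tm: "t i \<le> t j" if "i \<le> j" for i j
        unfolding t_def using that \<open>a \<le> b\<close> by (intro add_left_mono mult_right_mono) auto
      have "F b - F a = (\<Sum>i<k. F (t (Suc i)) - F (t i))"
        by (subst sum_lessThan_telescope) (simp add: t)
      also have "\<dots> \<le> (\<Sum>i<k. c * (t (Suc i) - t i)\<^sup>2)"
      proof (rule sum_mono)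
        fix i assume "i \<in> {..<k}"
        then show "F (t (Suc i)) - F (t i) \<le> c * (t (Suc i) - t i)\<^sup>2"
          using tm[of 0 i] tm[of i "Suc i"] tm[of "Suc i" k] t elim by (intro F) auto
      qed
      also have "\<dots> = c * (b - a)\<^sup>2 / real k"
        using elim by (simp add: t power2_eq_square)
      finally show ?case .
    qed
  qed
  ultimately have "F b - F a \<le> 0"
    by (rule tendsto_lowerbound) simp
  then show ?thesis by simp
qed

lemma integral_rectangle_error:
  fixes h :: "real \<Rightarrow> real"
  assumes h: "L-lipschitz_on {a..b} h" and "a \<le> b" "r \<in> {a..b}"
  shows "\<bar>integral {a..b} h - h r * (b - a)\<bar> \<le> L * (b - a)\<^sup>2"
proof -
  have c: "continuous_on {a..b} h" using h by (rule lipschitz_on_continuous_on)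
  have L: "L \<ge> 0" using h by (rule lipschitz_on_nonneg)
  have "integral {a..b} h - h r * (b - a) = integral {a..b} (\<lambda>x. h x - h r)"
    using c \<open>a \<le> b\<close> by (subst Henstock_Kurzweil_Integration.integral_diff)
      (auto intro!: integrable_continuous_real simp: mult.commute)
  also have "norm \<dots> \<le> L * (b - a) * (b - a)"
  proof (rule integral_bound)
    fix t assume t: "t \<in> {a..b}"
    have "dist (h t) (h r) \<le> L * dist t r" using h t assms(3) by (rule lipschitz_onD)
    also have "\<dots> \<le> L * (b - a)" using t assms(3) L by (intro mult_left_mono) (auto simp: dist_real_def)
    finally show "norm (h t - h r) \<le> L * (b - a)" by (simp add: dist_norm)
  qed (use assms c in \<open>auto intro!: continuous_intros\<close>)
  finally show ?thesis by (simp add: power2_eq_square mult.assoc)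
qed

lemma integral_increment:
  fixes h :: "real \<Rightarrow> real"
  assumes "continuous_on {a..b} h" "a \<le> s" "s \<le> t" "t \<le> b"
  shows "integral {a..t} h - integral {a..s} h = integral {s..t} h"
proof -
  have "h integrable_on {a..t}"
    by (rule integrable_continuous_real, rule continuous_on_subset[OF assms(1)]) (use assms in auto)
  from Henstock_Kurzweil_Integration.integral_combine[OF assms(2,3) this]
  show ?thesis by simp
qed

lemma increment_le_integral:
  fixes h u :: "real \<Rightarrow> real"
  assumes h: "L-lipschitz_on {0..l} h" and "0 \<le> l" "\<delta> > 0"
    and u: "\<And>s t. 0 \<le> s \<Longrightarrow> s \<le> t \<Longrightarrow> t \<le> l \<Longrightarrow> t - s < \<delta> \<Longrightarrow> \<exists>r\<in>{s..t}. u t - u s \<le> h r * (t - s)"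
  shows "u l - u 0 \<le> integral {0..l} h"
proof -
  have c: "continuous_on {0..l} h" using h by (rule lipschitz_on_continuous_on)
  have "u l - integral {0..l} h \<le> u 0 - integral {0..0} h"
  proof (rule le_of_quadratic_increments[where c = L and F = "\<lambda>t. u t - integral {0..t} h"])
    fix s t assume st: "0 \<le> s" "s \<le> t" "t \<le> l" "t - s < \<delta>"
    obtain r where r: "r \<in> {s..t}" "u t - u s \<le> h r * (t - s)" using u st by blast
    have "L-lipschitz_on {s..t} h" by (rule lipschitz_on_subset[OF h]) (use st in auto)
    then have "\<bar>integral {s..t} h - h r * (t - s)\<bar> \<le> L * (t - s)\<^sup>2"
      using integral_rectangle_error st r by blast
    then show "u t - integral {0..t} h - (u s - integral {0..s} h) \<le> L * (t - s)\<^sup>2"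
      using integral_increment[OF c, of s t] st r by auto
  qed (use assms in auto)
  then show ?thesis by simp
qed

lemma nn_integral_eq_integral_continuous:
  fixes h :: "real \<Rightarrow> real"
  assumes c: "continuous_on {a..b} h" and nn: "\<And>s. s \<in> {a..b} \<Longrightarrow> 0 \<le> h s"
  shows "(\<integral>\<^sup>+ s \<in> {a..b}. ennreal (h s) \<partial>lborel) = ennreal (integral {a..b} h)"
proof -
  have i: "set_integrable lborel {a..b} h" using c by (rule borel_integrable_atLeastAtMost')
  have "(\<integral>\<^sup>+ s \<in> {a..b}. ennreal (h s) \<partial>lborel) = (\<integral>\<^sup>+ s. ennreal (indicator {a..b} s *\<^sub>R h s) \<partial>lborel)"
    by (rule nn_integral_cong) (auto simp: indicator_def)
  also have "\<dots> = ennreal (LINT s:{a..b}|lborel. h s)"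
    unfolding set_lebesgue_integral_def
    by (rule nn_integral_eq_integral) (use i nn in \<open>auto simp: set_integrable_def indicator_def\<close>)
  also have "(LINT s:{a..b}|lborel. h s) = integral {a..b} h"
    using i by (rule set_borel_integral_eq_integral)
  finally show ?thesis .
qed

lemma lipschitz_on_comp_arc_length_reparam:
  assumes rect: "rectifiable_curve S a b \<gamma>" and g: "L-lipschitz_on S g"
  shows "L-lipschitz_on {0..length_upto a \<gamma> b} (\<lambda>s. g (arc_length_reparam a b \<gamma> s))"
proof (rule lipschitz_onI)
  show L: "0 \<le> L" using g by (rule lipschitz_on_nonneg)
  fix s t assume st: "s \<in> {0..length_upto a \<gamma> b}" "t \<in> {0..length_upto a \<gamma> b}"
  have "dist (g (arc_length_reparam a b \<gamma> s)) (g (arc_length_reparam a b \<gamma> t))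
      \<le> L * dist (arc_length_reparam a b \<gamma> s) (arc_length_reparam a b \<gamma> t)"
    by (rule lipschitz_onD[OF g]) (use arc_length_reparam_in[OF rect] st in auto)
  also have "\<dots> \<le> L * dist s t"
    using arc_length_reparam_dist_le[OF rect, of s t] arc_length_reparam_dist_le[OF rect, of t s] st
    by (intro mult_left_mono L) (cases "s \<le> t"; simp add: dist_real_def dist_commute)
  finally show "dist (g (arc_length_reparam a b \<gamma> s)) (g (arc_length_reparam a b \<gamma> t)) \<le> L * dist s t" .
qed

text \<open>A pointwise bound on the growth of \<open>w\<close> at a small scale integrates along the arc length
  parametrization. The bound is one-sided, but it applies in both directions along the curve, with \<open>g\<close>
  evaluated at the point that one starts from.\<close>

lemma upper_gradient_of_small_scale_growth:
  assumes g: "L-lipschitz_on S g" and gnn: "\<And>z. z \<in> S \<Longrightarrow> 0 \<le> g z" and \<epsilon>: "\<epsilon> > 0"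
    and w: "\<And>y z. y \<in> S \<Longrightarrow> z \<in> S \<Longrightarrow> dist y z \<le> \<epsilon> \<Longrightarrow> w z - w y \<le> g y * dist y z"
  shows "upper_gradient S w (\<lambda>z. ennreal (g z))"
  unfolding upper_gradient_def
proof (intro conjI allI impI)
  have "g \<in> borel_measurable (restrict_space borel S)"
    by (rule borel_measurable_continuous_on_restrict) (rule lipschitz_on_continuous_on[OF g])
  then show "(\<lambda>z. ennreal (g z)) \<in> borel_measurable (restrict_space borel S)" by measurable
next
  fix a b and \<gamma> :: "real \<Rightarrow> 'a"
  assume rect: "rectifiable_curve S a b \<gamma>"
  define l where "l = length_upto a \<gamma> b"
  define \<beta> where "\<beta> = arc_length_reparam a b \<gamma>"
  define h where "h = (\<lambda>s. g (\<beta> s))"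
  have ab: "a \<le> b" using rect by (simp add: rectifiable_curve_def)
  have l: "l \<ge> 0" by (simp add: l_def length_upto_def)
  have h: "L-lipschitz_on {0..l} h"
    using lipschitz_on_comp_arc_length_reparam[OF rect g] by (simp add: h_def l_def \<beta>_def)
  have \<beta>S: "\<beta> s \<in> S" if "s \<in> {0..l}" for s
    using arc_length_reparam_in[OF rect] that by (simp add: l_def \<beta>_def)
  have \<beta>d: "dist (\<beta> s) (\<beta> t) \<le> t - s" if "0 \<le> s" "s \<le> t" "t \<le> l" for s t
    using arc_length_reparam_dist_le[OF rect] that by (simp add: l_def \<beta>_def)
  have ends: "\<beta> 0 = \<gamma> a" "\<beta> l = \<gamma> b"
    using arc_length_reparam_length_upto[OF rect, of a] arc_length_reparam_length_upto[OF rect, of b] ab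
    by (simp_all add: l_def \<beta>_def length_upto_start[OF rect])
  have "w (\<beta> l) - w (\<beta> 0) \<le> integral {0..l} h"
  proof (rule increment_le_integral[OF h l \<epsilon>])
    fix s t assume st: "0 \<le> s" "s \<le> t" "t \<le> l" "t - s < \<epsilon>"
    have "w (\<beta> t) - w (\<beta> s) \<le> g (\<beta> s) * dist (\<beta> s) (\<beta> t)"
      by (rule w) (use \<beta>S \<beta>d[of s t] st in auto)
    also have "\<dots> \<le> h s * (t - s)"
      unfolding h_def using \<beta>d[of s t] st gnn \<beta>S[of s] by (intro mult_left_mono) auto
    finally show "\<exists>r\<in>{s..t}. w (\<beta> t) - w (\<beta> s) \<le> h r * (t - s)" using st by force
  qed
  moreover have "- w (\<beta> l) - (- w (\<beta> 0)) \<le> integral {0..l} h"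
  proof (rule increment_le_integral[OF h l \<epsilon>])
    fix s t assume st: "0 \<le> s" "s \<le> t" "t \<le> l" "t - s < \<epsilon>"
    have "w (\<beta> s) - w (\<beta> t) \<le> g (\<beta> t) * dist (\<beta> t) (\<beta> s)"
      by (rule w) (use \<beta>S \<beta>d[of s t] st in \<open>auto simp: dist_commute\<close>)
    also have "\<dots> \<le> h t * (t - s)"
      unfolding h_def using \<beta>d[of s t] st gnn \<beta>S[of t] by (intro mult_left_mono) (auto simp: dist_commute)
    finally show "\<exists>r\<in>{s..t}. - w (\<beta> t) - (- w (\<beta> s)) \<le> h r * (t - s)" using st by force
  qed
  ultimately have "\<bar>w (\<gamma> a) - w (\<gamma> b)\<bar> \<le> integral {0..l} h" by (simp add: ends)
  also have "ennreal (integral {0..l} h) = (\<integral>\<^sup>+ s \<in> {0..l}. ennreal (h s) \<partial>lborel)"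
    by (rule nn_integral_eq_integral_continuous[symmetric])
      (use h gnn \<beta>S in \<open>auto simp: h_def intro: lipschitz_on_continuous_on\<close>)
  finally show "ennreal \<bar>w (\<gamma> a) - w (\<gamma> b)\<bar> \<le> line_integral a b \<gamma> (\<lambda>z. ennreal (g z))"
    by (simp add: line_integral_def h_def l_def \<beta>_def length_upto_def ennreal_leI)
qed

text \<open>The hypothesis \<open>slow\<close> says that, up to an error that vanishes at small scale, \<open>\<gamma>\<close> spends at
  least \<open>g m\<close> units of time per unit of length, for every \<open>m\<close>. Hence the integral of \<open>g m\<close> with
  respect to arc length is at most the total time, and monotone convergence carries this over to \<open>f\<close>.\<close>

lemma admissible_curve_of_slow_curve:
  fixes \<gamma> :: "real \<Rightarrow> 'a::metric_space" and g :: "nat \<Rightarrow> 'a \<Rightarrow> real"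
  assumes T: "0 \<le> T" and \<gamma>S: "\<And>t. t \<in> {0..T} \<Longrightarrow> \<gamma> t \<in> S"
    and \<gamma>d: "\<And>s t. 0 \<le> s \<Longrightarrow> s \<le> t \<Longrightarrow> t \<le> T \<Longrightarrow> dist (\<gamma> s) (\<gamma> t) \<le> t - s"
    and slow: "\<And>m s t. 0 \<le> s \<Longrightarrow> s \<le> t \<Longrightarrow> t \<le> T \<Longrightarrow>
      (g m (\<gamma> s) - L m * (t - s)) * dist (\<gamma> s) (\<gamma> t) \<le> t - s"
    and g: "\<And>m. (L m)-lipschitz_on S (g m)" and gnn: "\<And>m z. z \<in> S \<Longrightarrow> 0 \<le> g m z"
    and inc: "\<And>m n z. z \<in> S \<Longrightarrow> m \<le> n \<Longrightarrow> g m z \<le> g n z"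
    and fg: "\<And>z. z \<in> S \<Longrightarrow> \<exists>m. f z \<le> g m z"
  shows "\<exists>l \<beta>. (l, \<beta>) \<in> admissible_curves S f (\<gamma> 0) (\<gamma> T) \<and>
    line_integral 0 l \<beta> (\<lambda>z. ennreal (f z)) \<le> ennreal T"
proof -
  have L: "L m \<ge> 0" for m using g by (rule lipschitz_on_nonneg)
  have "curve_length 0 T \<gamma> \<le> ennreal (T - 0)" by (rule curve_length_le) (use T \<gamma>d in auto)
  moreover have "dist (\<gamma> s) (\<gamma> t) \<le> dist s t" if "s \<in> {0..T}" "t \<in> {0..T}" for s t
    using \<gamma>d[of s t] \<gamma>d[of t s] that by (cases "s \<le> t") (auto simp: dist_real_def dist_commute)
  then have "continuous_on {0..T} \<gamma>"
    unfolding continuous_on_iff by (meson le_less_trans)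
  ultimately have rect: "rectifiable_curve S 0 T \<gamma>"
    using T \<gamma>S by (auto simp: rectifiable_curve_def intro: le_less_trans)
  define l where "l = length_upto 0 \<gamma> T"
  define \<beta> where "\<beta> = arc_length_reparam 0 T \<gamma>"
  define \<Lambda> where "\<Lambda> = length_upto 0 \<gamma>"
  have \<Lambda>\<beta>: "\<beta> (\<Lambda> t) = \<gamma> t" if "t \<in> {0..T}" for t
    using arc_length_reparam_length_upto[OF rect that] by (simp add: \<Lambda>_def \<beta>_def)
  have \<Lambda>0: "\<Lambda> 0 = 0" and \<Lambda>T: "\<Lambda> T = l" using length_upto_start[OF rect] by (simp_all add: \<Lambda>_def l_def)
  have \<Lambda>m: "\<Lambda> s \<le> \<Lambda> t" if "0 \<le> s" "s \<le> t" "t \<le> T" for s t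
    using length_upto_mono[OF rect] that by (simp add: \<Lambda>_def)
  have \<Lambda>d: "\<Lambda> t - \<Lambda> s \<le> t - s" if "0 \<le> s" "s \<le> t" "t \<le> T" for s t
    unfolding \<Lambda>_def by (rule length_upto_diff_le[OF rect]) (use that \<gamma>d in auto)
  have l: "l \<ge> 0" by (simp add: l_def length_upto_def)
  have \<beta>S: "\<beta> s \<in> S" if "s \<in> {0..l}" for s
    using arc_length_reparam_in[OF rect] that by (simp add: l_def \<beta>_def)
  \<comment> \<open>The bound passes from chords to lengths because, where the factor \<open>\<kappa>\<close> on the left is
    positive, \<open>\<gamma>\<close> is Lipschitz with constant \<open>1/\<kappa>\<close> on the whole of \<open>[s, t]\<close>.\<close>
  have slow': "(g m (\<gamma> s) - L m * (t - s)) * (\<Lambda> t - \<Lambda> s) \<le> t - s" if st: "0 \<le> s" "s \<le> t" "t \<le> T" for m s t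
  proof (cases "g m (\<gamma> s) - L m * (t - s) > 0")
    case True
    define \<kappa> where "\<kappa> = g m (\<gamma> s) - L m * (t - s)"
    have "\<Lambda> t - \<Lambda> s \<le> t / \<kappa> - s / \<kappa>"
      unfolding \<Lambda>_def
    proof (rule length_upto_diff_le[OF rect])
      fix u v assume uv: "s \<le> u" "u \<le> v" "v \<le> t"
      have "dist (g m (\<gamma> s)) (g m (\<gamma> u)) \<le> L m * dist (\<gamma> s) (\<gamma> u)"
        by (rule lipschitz_onD[OF g]) (use \<gamma>S uv st in auto)
      also have "\<dots> \<le> L m * (u - s)" by (intro mult_left_mono L \<gamma>d) (use uv st in auto)
      finally have "g m (\<gamma> s) - L m * (u - s) \<le> g m (\<gamma> u)" by (simp add: dist_real_def)
      moreover have "L m * (u - s) + L m * (v - u) \<le> L m * (t - s)"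
        using uv L[of m] by (simp add: mult_left_mono flip: distrib_left)
      ultimately have "\<kappa> \<le> g m (\<gamma> u) - L m * (v - u)" by (simp add: \<kappa>_def)
      then have "\<kappa> * dist (\<gamma> u) (\<gamma> v) \<le> (g m (\<gamma> u) - L m * (v - u)) * dist (\<gamma> u) (\<gamma> v)"
        by (intro mult_right_mono) auto
      also have "\<dots> \<le> v - u" by (rule slow) (use uv st in auto)
      finally show "dist (\<gamma> u) (\<gamma> v) \<le> v / \<kappa> - u / \<kappa>"
        using True unfolding \<kappa>_def[symmetric] by (simp add: field_simps)
    qed (use st in auto)
    then show ?thesis using True unfolding \<kappa>_def[symmetric] by (simp add: field_simps)
  next
    case False
    then have "(g m (\<gamma> s) - L m * (t - s)) * (\<Lambda> t - \<Lambda> s) \<le> 0"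
      using \<Lambda>m[OF st] by (intro mult_nonpos_nonneg) auto
    then show ?thesis using st by simp
  qed
  have int_g: "(\<integral>\<^sup>+ s \<in> {0..l}. ennreal (g m (\<beta> s)) \<partial>lborel) \<le> ennreal T" for m
  proof -
    define h where "h = (\<lambda>s. g m (\<beta> s))"
    have h: "(L m)-lipschitz_on {0..l} h"
      using lipschitz_on_comp_arc_length_reparam[OF rect g] by (simp add: h_def l_def \<beta>_def)
    have c: "continuous_on {0..l} h" using h by (rule lipschitz_on_continuous_on)
    have "integral {0..\<Lambda> T} h - T \<le> integral {0..\<Lambda> 0} h - 0"
    proof (rule le_of_quadratic_increments[where c = "2 * L m" and \<delta> = 1 and F = "\<lambda>t. integral {0..\<Lambda> t} h - t"])
      fix s t assume st: "0 \<le> s" "s \<le> t" "t \<le> T"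
      have \<Lambda>st: "0 \<le> \<Lambda> s" "\<Lambda> s \<le> \<Lambda> t" "\<Lambda> t \<le> l" "\<Lambda> t - \<Lambda> s \<le> t - s"
        using \<Lambda>m[of 0 s] \<Lambda>m[of s t] \<Lambda>m[of t T] \<Lambda>d[of s t] st \<Lambda>0 \<Lambda>T by auto
      have "(L m)-lipschitz_on {\<Lambda> s..\<Lambda> t} h" by (rule lipschitz_on_subset[OF h]) (use \<Lambda>st in auto)
      then have "\<bar>integral {\<Lambda> s..\<Lambda> t} h - h (\<Lambda> s) * (\<Lambda> t - \<Lambda> s)\<bar> \<le> L m * (\<Lambda> t - \<Lambda> s)\<^sup>2"
        by (rule integral_rectangle_error) (use \<Lambda>st in auto)
      moreover have "L m * (\<Lambda> t - \<Lambda> s)\<^sup>2 \<le> L m * (t - s)\<^sup>2"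
        using \<Lambda>st by (intro mult_left_mono power_mono L) auto
      moreover have "integral {0..\<Lambda> t} h - integral {0..\<Lambda> s} h = integral {\<Lambda> s..\<Lambda> t} h"
        by (rule integral_increment[OF c]) (use \<Lambda>st in auto)
      moreover have "h (\<Lambda> s) * (\<Lambda> t - \<Lambda> s) - L m * (t - s) * (\<Lambda> t - \<Lambda> s) \<le> t - s"
        using slow'[of s t m] \<Lambda>\<beta>[of s] st by (simp add: h_def left_diff_distrib)
      moreover have "L m * (t - s) * (\<Lambda> t - \<Lambda> s) \<le> L m * (t - s) * (t - s)"
        using \<Lambda>st st L[of m] by (intro mult_left_mono) auto
      ultimately show "integral {0..\<Lambda> t} h - t - (integral {0..\<Lambda> s} h - s) \<le> 2 * L m * (t - s)\<^sup>2"
        by (simp add: power2_eq_square)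
    qed (use T in auto)
    then have "integral {0..l} h \<le> T" by (simp add: \<Lambda>0 \<Lambda>T)
    moreover have "(\<integral>\<^sup>+ s \<in> {0..l}. ennreal (h s) \<partial>lborel) = ennreal (integral {0..l} h)"
      by (rule nn_integral_eq_integral_continuous[OF c]) (use gnn \<beta>S in \<open>auto simp: h_def\<close>)
    ultimately show ?thesis by (simp add: h_def ennreal_leI)
  qed
  have par: "arc_length_parametrized l \<beta>"
    using curve_length_arc_length_reparam[OF rect] by (simp add: arc_length_parametrized_def l_def \<beta>_def)
  have "curve_length 0 l \<beta> = ennreal l"
    using par l by (auto simp: arc_length_parametrized_def)
  then have "line_integral 0 l \<beta> (\<lambda>z. ennreal (f z)) = (\<integral>\<^sup>+ s \<in> {0..l}. ennreal (f (arc_length_reparam 0 l \<beta> s)) \<partial>lborel)"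
    using l by (simp add: line_integral_def)
  also have "\<dots> = (\<integral>\<^sup>+ s \<in> {0..l}. ennreal (f (\<beta> s)) \<partial>lborel)"
    by (rule nn_integral_cong) (auto simp: arc_length_reparam_of_parametrized[OF par] indicator_def)
  also have "\<dots> \<le> (\<integral>\<^sup>+ s. (SUP m. ennreal (g m (\<beta> s)) * indicator {0..l} s) \<partial>lborel)"
  proof (rule nn_integral_mono)
    fix s
    show "ennreal (f (\<beta> s)) * indicator {0..l} s \<le> (SUP m. ennreal (g m (\<beta> s)) * indicator {0..l} s)"
    proof (cases "s \<in> {0..l}")
      case True
      then obtain m where "f (\<beta> s) \<le> g m (\<beta> s)" using fg \<beta>S by blast
      then show ?thesis using True by (intro SUP_upper2[of m]) (auto intro: ennreal_leI)
    qed auto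
  qed
  also have "\<dots> = (SUP m. (\<integral>\<^sup>+ s. ennreal (g m (\<beta> s)) * indicator {0..l} s \<partial>lborel))"
  proof (rule nn_integral_monotone_convergence_SUP)
    show "incseq (\<lambda>m s. ennreal (g m (\<beta> s)) * indicator {0..l} s)"
      using inc \<beta>S by (auto simp: incseq_def le_fun_def indicator_def intro!: ennreal_leI)
    fix m
    have "continuous_on {0..l} (\<lambda>s. g m (\<beta> s))"
      using lipschitz_on_comp_arc_length_reparam[OF rect g[of m]] lipschitz_on_continuous_on
      by (auto simp: l_def \<beta>_def)
    then have "(\<lambda>s. indicator {0..l} s *\<^sub>R g m (\<beta> s)) \<in> borel_measurable borel"
      by (intro borel_measurable_continuous_on_indicator) auto
    then have "(\<lambda>s. ennreal (indicator {0..l} s *\<^sub>R g m (\<beta> s))) \<in> borel_measurable lborel"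
      by simp
    moreover have "(\<lambda>s. ennreal (indicator {0..l} s *\<^sub>R g m (\<beta> s))) = (\<lambda>s. ennreal (g m (\<beta> s)) * indicator {0..l} s)"
      by (auto simp: indicator_def)
    ultimately show "(\<lambda>s. ennreal (g m (\<beta> s)) * indicator {0..l} s) \<in> borel_measurable lborel"
      by simp
  qed
  also have "\<dots> \<le> ennreal T" by (rule SUP_least) (rule int_g)
  finally have le: "line_integral 0 l \<beta> (\<lambda>z. ennreal (f z)) \<le> ennreal T" .
  have "(l, \<beta>) \<in> admissible_curves S f (\<gamma> 0) (\<gamma> T)"
    unfolding admissible_curves_def
    using rectifiable_arc_length_reparam[OF rect] par le \<Lambda>\<beta>[of 0] \<Lambda>\<beta>[of T] T \<Lambda>0 \<Lambda>T
    by (auto simp: l_def \<beta>_def intro: le_less_trans)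
  with le show ?thesis by blast
qed

section \<open>Chains and their limits\<close>

text \<open>Chains are discrete substitutes for curves. A chain cost is a left Riemann sum for the integral of
  \<open>g\<close>, so appending the step from \<open>y\<close> to \<open>z\<close> costs \<open>g y * dist y z\<close>. Unlike the infimum of
  line integrals, the infimum of chain costs is finite on a connected set and, for bounded \<open>g\<close>,
  continuous; this follows from the definition without any knowledge about curves.\<close>

definition eps_chain :: "'a::metric_space set \<Rightarrow> real \<Rightarrow> nat \<Rightarrow> (nat \<Rightarrow> 'a) \<Rightarrow> bool" where
  "eps_chain S \<epsilon> N c \<longleftrightarrow> c ` {..N} \<subseteq> S \<and> (\<forall>i<N. dist (c i) (c (Suc i)) \<le> \<epsilon>)"

definition chain_cost :: "('a::metric_space \<Rightarrow> real) \<Rightarrow> nat \<Rightarrow> (nat \<Rightarrow> 'a) \<Rightarrow> real" where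
  "chain_cost g N c = (\<Sum>i<N. g (c i) * dist (c i) (c (Suc i)))"

definition chain_costs ::
    "'a::metric_space set \<Rightarrow> ('a \<Rightarrow> real) \<Rightarrow> real \<Rightarrow> 'a \<Rightarrow> 'a \<Rightarrow> real set" where
  "chain_costs S g \<epsilon> x y = {chain_cost g N c | N c. eps_chain S \<epsilon> N c \<and> c 0 = x \<and> c N = y}"

lemma eps_chain_extend:
  assumes "eps_chain S \<epsilon> N c" "c N = y" "z \<in> S" "dist y z \<le> \<epsilon>"
  shows "eps_chain S \<epsilon> (Suc N) (c(Suc N := z))"
    and "chain_cost g (Suc N) (c(Suc N := z)) = chain_cost g N c + g y * dist y z"
  using assms by (auto simp: eps_chain_def chain_cost_def le_Suc_eq less_Suc_eq intro!: sum.cong)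

lemma chain_costs_nonempty:
  assumes "connected S" "x \<in> S" "y \<in> S" "\<epsilon> > 0"
  shows "chain_costs S g \<epsilon> x y \<noteq> {}"
proof -
  define R where "R y \<longleftrightarrow> (\<exists>N c. eps_chain S \<epsilon> N c \<and> c 0 = x \<and> c N = y)" for y
  have step: "R z" if "R y" "z \<in> S" "dist y z \<le> \<epsilon>" for y z
  proof -
    obtain N c where "eps_chain S \<epsilon> N c" "c 0 = x" "c N = y" using \<open>R y\<close> R_def by blast
    then show ?thesis unfolding R_def
      using eps_chain_extend(1)[of S \<epsilon> N c y z] that(2,3)
      by (intro exI[of _ "Suc N"] exI[of _ "c(Suc N := z)"]) auto
  qed
  have "R x" unfolding R_def
    using \<open>x \<in> S\<close> by (intro exI[of _ 0] exI[of _ "\<lambda>_. x"]) (auto simp: eps_chain_def)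
  have "R x = R y"
  proof (rule connected_equivalence_relation[OF \<open>connected S\<close> \<open>x \<in> S\<close> \<open>y \<in> S\<close>, where R = "\<lambda>y z. R y = R z"])
    fix a assume "a \<in> S"
    have "R a = R z" if "z \<in> S" "dist a z < \<epsilon>" for z
      using step[of a z] step[of z a] that \<open>a \<in> S\<close> by (auto simp: dist_commute)
    then show "\<exists>T. openin (top_of_set S) T \<and> a \<in> T \<and> (\<forall>z\<in>T. R a = R z)"
    proof (intro exI[of _ "S \<inter> ball a \<epsilon>"] conjI ballI)
      show "openin (top_of_set S) (S \<inter> ball a \<epsilon>)" by (simp add: openin_open_Int)
      show "a \<in> S \<inter> ball a \<epsilon>" using \<open>a \<in> S\<close> \<open>\<epsilon> > 0\<close> by simp
      fix z assume "z \<in> S \<inter> ball a \<epsilon>"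
      then show "R a = R z" by (intro \<open>\<And>z. z \<in> S \<Longrightarrow> dist a z < \<epsilon> \<Longrightarrow> R a = R z\<close>) auto
    qed
  qed auto
  then show ?thesis using \<open>R x\<close> unfolding R_def chain_costs_def by blast
qed

lemma chain_cost_nonneg:
  "eps_chain S \<epsilon> N c \<Longrightarrow> (\<And>z. z \<in> S \<Longrightarrow> 0 \<le> g z) \<Longrightarrow> 0 \<le> chain_cost g N c"
  unfolding chain_cost_def eps_chain_def by (intro sum_nonneg mult_nonneg_nonneg) (auto simp: image_subset_iff)

lemma Inf_chain_costs_self:
  assumes "x \<in> S" "\<And>z. z \<in> S \<Longrightarrow> 0 \<le> g z"
  shows "Inf (chain_costs S g \<epsilon> x x) = 0"
proof (rule cInf_eq_minimum)
  show "0 \<in> chain_costs S g \<epsilon> x x"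
    unfolding chain_costs_def using \<open>x \<in> S\<close>
    by (auto intro!: exI[of _ 0] exI[of _ "\<lambda>_. x"] simp: eps_chain_def chain_cost_def)
  fix v assume "v \<in> chain_costs S g \<epsilon> x x"
  then obtain N c where c: "v = chain_cost g N c" "eps_chain S \<epsilon> N c"
    by (auto simp: chain_costs_def)
  show "0 \<le> v" unfolding c(1) using c(2) assms(2) by (rule chain_cost_nonneg)
qed

lemma Inf_chain_costs_step:
  assumes "connected S" "x \<in> S" "y \<in> S" "z \<in> S" "\<epsilon> > 0" "dist y z \<le> \<epsilon>"
    and g: "\<And>z. z \<in> S \<Longrightarrow> 0 \<le> g z"
  shows "Inf (chain_costs S g \<epsilon> x z) - Inf (chain_costs S g \<epsilon> x y) \<le> g y * dist y z"
proof -
  have "Inf (chain_costs S g \<epsilon> x z) - g y * dist y z \<le> Inf (chain_costs S g \<epsilon> x y)"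
  proof (rule cInf_greatest)
    show "chain_costs S g \<epsilon> x y \<noteq> {}" by (rule chain_costs_nonempty) (use assms in auto)
    fix v assume "v \<in> chain_costs S g \<epsilon> x y"
    then obtain N c where c: "v = chain_cost g N c" "eps_chain S \<epsilon> N c" "c 0 = x" "c N = y"
      by (auto simp: chain_costs_def)
    have "v + g y * dist y z \<in> chain_costs S g \<epsilon> x z"
      unfolding chain_costs_def using eps_chain_extend[OF c(2,4), of z] assms c
      by (auto intro!: exI[of _ "Suc N"] exI[of _ "c(Suc N := z)"])
    moreover have "bdd_below (chain_costs S g \<epsilon> x z)"
      unfolding chain_costs_def using chain_cost_nonneg g by (intro bdd_belowI[of _ 0]) blast
    ultimately have "Inf (chain_costs S g \<epsilon> x z) \<le> v + g y * dist y z" by (rule cInf_lower)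
    then show "Inf (chain_costs S g \<epsilon> x z) - g y * dist y z \<le> v" by simp
  qed
  then show ?thesis by simp
qed

lemma continuous_on_Inf_chain_costs:
  assumes "connected S" "x \<in> S" "\<epsilon> > 0"
    and g: "\<And>z. z \<in> S \<Longrightarrow> 0 \<le> g z" "\<And>z. z \<in> S \<Longrightarrow> g z \<le> M"
  shows "continuous_on S (\<lambda>y. Inf (chain_costs S g \<epsilon> x y))"
  unfolding continuous_on_iff
proof (intro ballI allI impI)
  fix y e :: real and y' assume "y' \<in> S" "e > (0::real)"
  have M: "M \<ge> 0" using g \<open>x \<in> S\<close> by (meson order.trans)
  show "\<exists>d>0. \<forall>z\<in>S. dist z y' < d \<longrightarrow> dist (Inf (chain_costs S g \<epsilon> x z)) (Inf (chain_costs S g \<epsilon> x y')) < e"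
  proof (intro exI[of _ "min \<epsilon> (e / (M + 1))"] conjI ballI impI)
    show "min \<epsilon> (e / (M + 1)) > 0" using \<open>e > 0\<close> \<open>\<epsilon> > 0\<close> M by simp
    fix z assume z: "z \<in> S" "dist z y' < min \<epsilon> (e / (M + 1))"
    have "g y' * dist z y' \<le> M * dist z y'" "g z * dist z y' \<le> M * dist z y'"
      using g z \<open>y' \<in> S\<close> by (auto intro: mult_right_mono)
    moreover have "M * dist z y' < e"
      using z M \<open>e > 0\<close> by (smt (verit, best) mult_left_mono mult_right_mono pos_less_divide_eq mult.commute zero_le_dist min_less_iff_conj distrib_left mult_cancel_left1)
    ultimately show "dist (Inf (chain_costs S g \<epsilon> x z)) (Inf (chain_costs S g \<epsilon> x y')) < e"
      using Inf_chain_costs_step[of S x z y' \<epsilon> g] Inf_chain_costs_step[of S x y' z \<epsilon> g] assms z \<open>y' \<in> S\<close>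
      by (auto simp: dist_real_def dist_commute)
  qed
qed

text \<open>A chain becomes a step function of time by travelling along it at unit cost per unit time. The
  error \<open>\<eta>\<close> bounds the cost of a single step.\<close>

lemma slow_step_function_of_chain:
  assumes c: "eps_chain S \<epsilon> N c" "c 0 = x" "c N = y"
    and T: "chain_cost g N c \<le> T"
    and g: "\<And>z. z \<in> S \<Longrightarrow> 1 \<le> g z" and \<eta>: "\<And>z. z \<in> S \<Longrightarrow> g z * \<epsilon> \<le> \<eta>" "0 \<le> \<eta>"
  shows "\<exists>\<gamma>. \<gamma> 0 = x \<and> \<gamma> T = y \<and> range \<gamma> \<subseteq> S \<and>
    (\<forall>s t L k. 0 \<le> s \<longrightarrow> s \<le> t \<longrightarrow> L-lipschitz_on S k \<longrightarrow> (\<forall>z\<in>S. k z \<le> g z) \<longrightarrow>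
      (k (\<gamma> s) - L * (t - s + \<eta>)) * dist (\<gamma> s) (\<gamma> t) \<le> t - s + \<eta>)"
proof -
  define A where "A i = chain_cost g i c" for i
  have A0: "A 0 = 0" and AS: "A (Suc i) = A i + g (c i) * dist (c i) (c (Suc i))" for i
    by (simp_all add: A_def chain_cost_def)
  have cS: "c i \<in> S" if "i \<le> N" for i using c(1) that by (auto simp: eps_chain_def)
  have step: "dist (c i) (c (Suc i)) \<le> g (c i) * dist (c i) (c (Suc i))"
    "g (c i) * dist (c i) (c (Suc i)) \<le> \<eta>" if "i < N" for i
  proof -
    have gi: "1 \<le> g (c i)" using g cS that by simp
    then show "dist (c i) (c (Suc i)) \<le> g (c i) * dist (c i) (c (Suc i))"
      by (simp add: mult_le_cancel_right1 mult_right_mono)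
    have "g (c i) * dist (c i) (c (Suc i)) \<le> g (c i) * \<epsilon>"
      using c(1) that gi by (intro mult_left_mono) (auto simp: eps_chain_def)
    also have "\<dots> \<le> \<eta>" using \<eta> cS that by simp
    finally show "g (c i) * dist (c i) (c (Suc i)) \<le> \<eta>" .
  qed
  have dA: "dist (c i) (c j) \<le> A j - A i" if "i \<le> j" "j \<le> N" for i j
    using that
  proof (induction j rule: dec_induct)
    case (step m)
    have "dist (c i) (c (Suc m)) \<le> dist (c i) (c m) + dist (c m) (c (Suc m))" by (rule dist_triangle)
    then show ?case using step \<open>\<And>i. i < N \<Longrightarrow> dist (c i) (c (Suc i)) \<le> g (c i) * dist (c i) (c (Suc i))\<close>[of m]
      by (simp add: AS)
  qed simp
  have Am: "A i \<le> A j" if "i \<le> j" "j \<le> N" for i j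
    using dA[OF that] zero_le_dist[of "c i" "c j"] by linarith
  \<comment> \<open>The number of steps that are paid for at time \<open>t\<close>; \<open>max 0 t\<close> makes the function total with
    values in \<open>S\<close>, as the compactness argument for these functions requires.\<close>
  define I where "I t = Max {i. i \<le> N \<and> A i \<le> max 0 t}" for t
  have fin: "finite {i. i \<le> N \<and> A i \<le> max 0 t}" for t by simp
  have ne: "{i. i \<le> N \<and> A i \<le> max 0 t} \<noteq> {}" for t
    by (auto intro!: exI[of _ 0] simp: A0)
  have I: "I t \<le> N" "A (I t) \<le> max 0 t" for t
    using Max_in[OF fin ne, of t] by (auto simp: I_def)
  have I_ge: "i \<le> I t" if "i \<le> N" "A i \<le> max 0 t" for i t
    unfolding I_def by (rule Max_ge[OF fin]) (use that in auto)
  define \<gamma> where "\<gamma> t = c (I t)" for t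
  have "dist x (\<gamma> 0) \<le> 0"
    using dA[of 0 "I 0"] I[of 0] A0 c(2) by (simp add: \<gamma>_def del: dist_le_zero_iff)
  then have "\<gamma> 0 = x" by simp
  moreover have "I T = N"
    using I_ge[of N T] I(1)[of T] T by (simp add: A_def)
  then have "\<gamma> T = y" using c(3) by (simp add: \<gamma>_def)
  moreover have "range \<gamma> \<subseteq> S" using cS I by (auto simp: \<gamma>_def)
  moreover have "(k (\<gamma> s) - L * (t - s + \<eta>)) * dist (\<gamma> s) (\<gamma> t) \<le> t - s + \<eta>"
    if st: "0 \<le> s" "s \<le> t" and k: "L-lipschitz_on S k" "\<forall>z\<in>S. k z \<le> g z" for s t L k
  proof -
    define i j where "i = I s" and "j = I t"
    define \<Delta> where "\<Delta> = t - s + \<eta>"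
    have \<Delta>: "\<Delta> \<ge> 0" using st \<eta> by (simp add: \<Delta>_def)
    have ij: "i \<le> j" "j \<le> N"
      using I_ge[of i t] I[of s] I[of t] st by (auto simp: i_def j_def)
    have "A j - A i \<le> \<Delta> \<or> i = N"
    proof (cases "i = N")
      case False
      then have "i < N" using ij by simp
      then have "A (Suc i) > s" using I_ge[of "Suc i" s] st by (force simp: i_def)
      then show ?thesis using step(2)[OF \<open>i < N\<close>] I(2)[of t] st by (auto simp: AS j_def \<Delta>_def)
    qed simp
    then have AD: "A j - A i \<le> \<Delta>" using ij \<Delta> by auto
    define \<kappa> where "\<kappa> = k (c i) - L * \<Delta>"
    have "\<kappa> * dist (c i) (c j) \<le> \<Delta>"
    proof (cases "\<kappa> \<ge> 0")
      case True
      have \<kappa>g: "\<kappa> \<le> g (c m)" if "i \<le> m" "m \<le> j" for m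
      proof -
        have "dist (k (c i)) (k (c m)) \<le> L * dist (c i) (c m)"
          by (rule lipschitz_onD[OF k(1)]) (use that ij cS in auto)
        also have "\<dots> \<le> L * \<Delta>"
          using dA[of i m] Am[of m j] AD that ij lipschitz_on_nonneg[OF k(1)] by (intro mult_left_mono) auto
        finally show ?thesis using k(2) cS[of m] that ij unfolding \<kappa>_def dist_real_def by force
      qed
      have "\<kappa> * dist (c i) (c m) \<le> A m - A i" if "i \<le> m" "m \<le> j" for m
        using that
      proof (induction m rule: dec_induct)
        case (step m)
        have "\<kappa> * dist (c i) (c (Suc m)) \<le> \<kappa> * (dist (c i) (c m) + dist (c m) (c (Suc m)))"
          by (intro mult_left_mono dist_triangle True)
        also have "\<dots> \<le> (A m - A i) + g (c m) * dist (c m) (c (Suc m))"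
          unfolding distrib_left using step \<kappa>g[of m] by (intro add_mono mult_right_mono) auto
        finally show ?case by (simp add: AS)
      qed simp
      then show ?thesis using AD ij by force
    next
      case False
      then have "\<kappa> * dist (c i) (c j) \<le> 0" by (intro mult_nonpos_nonneg) auto
      then show ?thesis using \<Delta> by simp
    qed
    then show ?thesis by (simp add: \<kappa>_def \<gamma>_def i_def j_def \<Delta>_def)
  qed
  ultimately show ?thesis by blast
qed

text \<open>Tychonoff's theorem replaces the Arzela-Ascoli theorem here: the step functions are
  discontinuous, but a pointwise cluster point is all that is needed, because every required property
  is a closed condition on two values of the curve.\<close>

lemma ex_pointwise_cluster_filter:
  fixes \<phi> :: "nat \<Rightarrow> 'b \<Rightarrow> 'a::metric_space"
  assumes "compact S" "\<And>n. range (\<phi> n) \<subseteq> S"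
  shows "\<exists>\<gamma> G. G \<noteq> bot \<and> G \<le> sequentially \<and> range \<gamma> \<subseteq> S \<and> (\<forall>t. ((\<lambda>n. \<phi> n t) \<longlongrightarrow> \<gamma> t) G)"
proof -
  have "compactin (product_topology (\<lambda>i. euclidean) UNIV) (PiE (UNIV :: 'b set) (\<lambda>_. S))"
    unfolding compactin_PiE using \<open>compact S\<close> by simp
  then have "compact (PiE (UNIV :: 'b set) (\<lambda>_. S))"
    by (simp add: euclidean_product_topology)
  moreover have "filtermap \<phi> sequentially \<noteq> bot" by (simp add: filtermap_bot_iff)
  moreover have "\<forall>\<^sub>F \<gamma> in filtermap \<phi> sequentially. \<gamma> \<in> PiE UNIV (\<lambda>_. S)"
    unfolding eventually_filtermap using assms(2) by (auto simp: PiE_UNIV_domain intro!: always_eventually)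
  ultimately obtain \<gamma> where \<gamma>: "\<gamma> \<in> PiE UNIV (\<lambda>_. S)" "inf (nhds \<gamma>) (filtermap \<phi> sequentially) \<noteq> bot"
    unfolding compact_filter by metis
  define G where "G = inf sequentially (filtercomap \<phi> (nhds \<gamma>))"
  have "G \<noteq> bot"
  proof
    assume "G = bot"
    then obtain P Q where P: "eventually P sequentially" and Q: "eventually Q (nhds \<gamma>)" and PQ: "\<And>n. P n \<Longrightarrow> \<not> Q (\<phi> n)"
      unfolding G_def trivial_limit_def eventually_inf eventually_filtercomap by metis
    have "\<forall>\<^sub>F \<psi> in filtermap \<phi> sequentially. \<not> Q \<psi>"
      unfolding eventually_filtermap using P by eventually_elim (rule PQ)
    with Q have "eventually (\<lambda>_. False) (inf (nhds \<gamma>) (filtermap \<phi> sequentially))"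
      unfolding eventually_inf by blast
    with \<gamma>(2) show False by (simp add: trivial_limit_def)
  qed
  moreover have "((\<lambda>n. \<phi> n t) \<longlongrightarrow> \<gamma> t) G" for t
  proof -
    have "continuous_on UNIV (\<lambda>\<psi>. \<psi> t :: 'a)" by (rule continuous_on_product_coordinates)
    then have "((\<lambda>\<psi>. \<psi> t) \<longlongrightarrow> \<gamma> t) (nhds \<gamma>)"
      using tendsto_at_iff_tendsto_nhds[of "\<lambda>\<psi>. \<psi> t" \<gamma>]
      unfolding continuous_on_def by blast
    moreover have "filterlim \<phi> (nhds \<gamma>) G"
      unfolding G_def filterlim_def by (meson filtermap_filtercomap filtermap_mono inf_le2 order.trans)
    ultimately show ?thesis by (rule filterlim_compose)
  qed
  ultimately show ?thesis
  proof (intro exI[of _ \<gamma>] exI[of _ G] conjI allI)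
    show "G \<le> sequentially" unfolding G_def by (rule inf_le1)
    show "range \<gamma> \<subseteq> S" using \<gamma>(1) by (auto simp: PiE_UNIV_domain)
  qed
qed

lemma slow_curve_of_chains:
  fixes g :: "nat \<Rightarrow> 'a::metric_space \<Rightarrow> real"
  assumes S: "compact S"
    and g: "\<And>m. (L m)-lipschitz_on S (g m)" "\<And>m z. z \<in> S \<Longrightarrow> 1 \<le> g m z"
    and inc: "\<And>m n z. z \<in> S \<Longrightarrow> m \<le> n \<Longrightarrow> g m z \<le> g n z"
    and \<epsilon>: "\<And>n z. z \<in> S \<Longrightarrow> g n z * \<epsilon> n \<le> inverse (real (Suc n))"
    and chain: "\<And>n. \<exists>v\<in>chain_costs S (g n) (\<epsilon> n) x y. v \<le> T"
  shows "\<exists>\<gamma>. \<gamma> 0 = x \<and> \<gamma> T = y \<and> range \<gamma> \<subseteq> S \<and>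
    (\<forall>s t. 0 \<le> s \<longrightarrow> s \<le> t \<longrightarrow> dist (\<gamma> s) (\<gamma> t) \<le> t - s \<and>
      (\<forall>m. (g m (\<gamma> s) - L m * (t - s)) * dist (\<gamma> s) (\<gamma> t) \<le> t - s))"
proof -
  define \<eta> where "\<eta> n = inverse (real (Suc n))" for n
  have "\<exists>\<phi>. \<phi> 0 = x \<and> \<phi> T = y \<and> range \<phi> \<subseteq> S \<and>
    (\<forall>s t L k. 0 \<le> s \<longrightarrow> s \<le> t \<longrightarrow> L-lipschitz_on S k \<longrightarrow> (\<forall>z\<in>S. k z \<le> g n z) \<longrightarrow>
      (k (\<phi> s) - L * (t - s + \<eta> n)) * dist (\<phi> s) (\<phi> t) \<le> t - s + \<eta> n)" for n
  proof -
    obtain N c where c: "eps_chain S (\<epsilon> n) N c" "c 0 = x" "c N = y" "chain_cost (g n) N c \<le> T"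
      using chain[of n] by (auto simp: chain_costs_def)
    show ?thesis by (rule slow_step_function_of_chain[OF c]) (use g \<epsilon> in \<open>auto simp: \<eta>_def\<close>)
  qed
  then obtain \<phi> where \<phi>: "\<And>n. \<phi> n 0 = x" "\<And>n. \<phi> n T = y" "\<And>n. range (\<phi> n) \<subseteq> S"
    and slow: "\<And>n s t L k. 0 \<le> s \<Longrightarrow> s \<le> t \<Longrightarrow> L-lipschitz_on S k \<Longrightarrow> (\<And>z. z \<in> S \<Longrightarrow> k z \<le> g n z) \<Longrightarrow>
      (k (\<phi> n s) - L * (t - s + \<eta> n)) * dist (\<phi> n s) (\<phi> n t) \<le> t - s + \<eta> n"
    by metis
  from ex_pointwise_cluster_filter[where \<phi> = \<phi>, OF S \<phi>(3)] obtain \<gamma> G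
    where \<gamma>G: "G \<noteq> bot \<and> G \<le> sequentially \<and> range \<gamma> \<subseteq> S \<and> (\<forall>t. ((\<lambda>n. \<phi> n t) \<longlongrightarrow> \<gamma> t) G)"
    by (elim exE)
  then have G: "G \<noteq> bot" "G \<le> sequentially" and \<gamma>S: "range \<gamma> \<subseteq> S"
    and lim: "\<And>t. ((\<lambda>n. \<phi> n t) \<longlongrightarrow> \<gamma> t) G"
    by simp_all
  have "(\<eta> \<longlongrightarrow> 0) G"
    using LIMSEQ_inverse_real_of_nat G(2) unfolding \<eta>_def by (rule tendsto_mono[rotated])
  \<comment> \<open>With \<open>k = 1\<close> this says that \<open>\<gamma>\<close> is 1-Lipschitz, and with \<open>k = g m\<close> it is the slowness.\<close>
  have limit: "(k (\<gamma> s) - L * (t - s)) * dist (\<gamma> s) (\<gamma> t) \<le> t - s"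
    if st: "0 \<le> s" "s \<le> t" and k: "L-lipschitz_on S k" "\<And>n z. n \<ge> m \<Longrightarrow> z \<in> S \<Longrightarrow> k z \<le> g n z" for s t L k m
  proof (rule tendsto_le[OF G(1)])
    have "((\<lambda>n. k (\<phi> n s)) \<longlongrightarrow> k (\<gamma> s)) G"
      by (rule continuous_on_tendsto_compose[OF lipschitz_on_continuous_on[OF k(1)] lim])
        (use \<gamma>S \<phi>(3) in \<open>auto simp: image_subset_iff intro!: always_eventually\<close>)
    then show "((\<lambda>n. (k (\<phi> n s) - L * (t - s + \<eta> n)) * dist (\<phi> n s) (\<phi> n t))
        \<longlongrightarrow> (k (\<gamma> s) - L * (t - s)) * dist (\<gamma> s) (\<gamma> t)) G"
      using lim \<open>(\<eta> \<longlongrightarrow> 0) G\<close> by (auto intro!: tendsto_eq_intros)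
    show "((\<lambda>n. t - s + \<eta> n) \<longlongrightarrow> t - s) G"
      using \<open>(\<eta> \<longlongrightarrow> 0) G\<close> by (auto intro!: tendsto_eq_intros)
    have "\<forall>\<^sub>F n in G. n \<ge> m" using eventually_ge_at_top G(2) by (rule filter_leD[rotated])
    then show "\<forall>\<^sub>F n in G. (k (\<phi> n s) - L * (t - s + \<eta> n)) * dist (\<phi> n s) (\<phi> n t) \<le> t - s + \<eta> n"
      by eventually_elim (rule slow[OF st k(1)], use k(2) in auto)
  qed
  show ?thesis
  proof (intro exI[of _ \<gamma>] conjI allI impI)
    show "\<gamma> 0 = x" using tendsto_unique[OF G(1) lim[of 0]] \<phi>(1) by simp
    show "\<gamma> T = y" using tendsto_unique[OF G(1) lim[of T]] \<phi>(2) by simp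
    fix s t :: real assume st: "0 \<le> s" "s \<le> t"
    show "dist (\<gamma> s) (\<gamma> t) \<le> t - s"
      using limit[OF st, of 0 "\<lambda>_. 1" 0] g(2) by (simp add: lipschitz_on_def)
    show "(g m (\<gamma> s) - L m * (t - s)) * dist (\<gamma> s) (\<gamma> t) \<le> t - s" for m
      by (rule limit[OF st g(1), of m]) (use inc in auto)
  qed (use \<gamma>S in auto)
qed

section \<open>Doubling measures\<close>

lemma doubling_measure_space:
  assumes "doubling_measure S \<mu> C\<^sub>d"
  shows "space \<mu> = S"
  using assms sets_eq_imp_space_eq[of \<mu> "restrict_space borel S"]
  by (simp add: doubling_measure_def space_restrict_space)

lemma doubling_measure_sets:
  assumes "doubling_measure S \<mu> C\<^sub>d" "B \<in> sets borel"
  shows "B \<inter> S \<in> sets \<mu>"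
  using assms by (auto simp: doubling_measure_def sets_restrict_space)

lemma doubling_measure_measure:
  assumes D: "doubling_measure S \<mu> C\<^sub>d" and x: "x \<in> S" and r: "r > 0"
  shows "0 < measure \<mu> (rel_ball S x r)"
    and "emeasure \<mu> (rel_ball S x r) = ennreal (measure \<mu> (rel_ball S x r))"
    and "measure \<mu> (rel_ball S x (2 * r)) \<le> C\<^sub>d * measure \<mu> (rel_ball S x r)"
proof -
  have fin: "emeasure \<mu> (rel_ball S x s) = ennreal (measure \<mu> (rel_ball S x s))" if "s > 0" for s
    using D x that by (intro emeasure_eq_ennreal_measure) (auto simp: doubling_measure_def less_top)
  show "emeasure \<mu> (rel_ball S x r) = ennreal (measure \<mu> (rel_ball S x r))" by (rule fin[OF r])
  have "0 < emeasure \<mu> (rel_ball S x r)" using D x r by (simp add: doubling_measure_def)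
  then show "0 < measure \<mu> (rel_ball S x r)" using fin[OF r] by simp
  have C: "C\<^sub>d \<ge> 1" using D by (simp add: doubling_measure_def)
  have "emeasure \<mu> (rel_ball S x (2 * r)) \<le> ennreal C\<^sub>d * emeasure \<mu> (rel_ball S x r)"
    using D x r by (simp add: doubling_measure_def)
  then have "ennreal (measure \<mu> (rel_ball S x (2 * r))) \<le> ennreal (C\<^sub>d * measure \<mu> (rel_ball S x r))"
    using fin[of r] fin[of "2 * r"] r C by (simp add: ennreal_mult)
  then show "measure \<mu> (rel_ball S x (2 * r)) \<le> C\<^sub>d * measure \<mu> (rel_ball S x r)"
    using C by (subst (asm) ennreal_le_iff) auto
qed

lemma finite_doubling_measure:
  assumes D: "doubling_measure S \<mu> C\<^sub>d" and "bounded S" "S \<noteq> {}"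
  shows "finite_measure \<mu>"
proof -
  obtain x where x: "x \<in> S" using assms by blast
  obtain R where R: "R > 0" "S \<subseteq> ball x R"
    using bounded_subset_ballD[OF \<open>bounded S\<close>] by blast
  then have "rel_ball S x R = S" by auto
  then have "emeasure \<mu> S < \<infinity>" using D x R(1) unfolding doubling_measure_def by metis
  then show ?thesis by (intro finite_measureI) (auto simp: doubling_measure_space[OF D])
qed

text \<open>The ratio \<open>R/r\<close> is reached after \<open>k\<close> doublings with \<open>2\<^sup>k \<le> 2 R/r\<close>, and
  \<open>C\<^sub>d = 2\<^sup>Q\<close>.\<close>

lemma doubling_measure_lower_bound:
  assumes D: "doubling_measure S \<mu> C\<^sub>d" and Q: "C\<^sub>d = 2 powr Q" "Q \<ge> 0"
    and R: "\<And>y z. y \<in> S \<Longrightarrow> z \<in> S \<Longrightarrow> dist y z < R"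
    and x: "x \<in> S" and r: "0 < r" "r \<le> R"
  shows "measure \<mu> S \<le> (2 * R / r) powr Q * measure \<mu> (rel_ball S x r)"
proof -
  have pow: "measure \<mu> (rel_ball S x (2 ^ k * r)) \<le> C\<^sub>d ^ k * measure \<mu> (rel_ball S x r)" for k
  proof (induction k)
    case (Suc k)
    have "measure \<mu> (rel_ball S x (2 * (2 ^ k * r))) \<le> C\<^sub>d * measure \<mu> (rel_ball S x (2 ^ k * r))"
      using doubling_measure_measure(3)[OF D x, of "2 ^ k * r"] r by simp
    also have "\<dots> \<le> C\<^sub>d * (C\<^sub>d ^ k * measure \<mu> (rel_ball S x r))"
      using Suc Q by (intro mult_left_mono) auto
    finally show ?case by (simp add: mult.assoc)
  qed simp
  define k where "k = nat \<lceil>log 2 (R / r)\<rceil>"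
  have l0: "log 2 (R / r) \<ge> 0" using r by (simp add: zero_le_log_cancel_iff)
  then have k: "log 2 (R / r) \<le> real k" "real k \<le> log 2 (R / r) + 1" by (auto simp: k_def)
  have "R / r = 2 powr log 2 (R / r)" using r by simp
  also have "\<dots> \<le> 2 powr real k" using k by (intro powr_mono) auto
  finally have "R \<le> 2 ^ k * r" using r by (simp add: powr_realpow field_simps)
  then have "rel_ball S x (2 ^ k * r) = S" using R x by force
  then have "measure \<mu> S \<le> C\<^sub>d ^ k * measure \<mu> (rel_ball S x r)" using pow[of k] by simp
  also have "\<dots> \<le> (2 * R / r) powr Q * measure \<mu> (rel_ball S x r)"
  proof (rule mult_right_mono)
    have "C\<^sub>d ^ k = 2 powr (real k * Q)" using Q by (simp add: powr_powr powr_realpow[symmetric] mult.commute)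
    also have "\<dots> \<le> 2 powr ((log 2 (R / r) + 1) * Q)"
      using k Q by (intro powr_mono mult_right_mono) auto
    also have "\<dots> = (2 * R / r) powr Q"
    proof -
      have "2 powr (log 2 (R / r) + 1) = 2 * R / r" using r by (simp add: powr_add)
      then show ?thesis by (metis powr_powr)
    qed
    finally show "C\<^sub>d ^ k \<le> (2 * R / r) powr Q" .
  qed simp
  finally show ?thesis .
qed

text \<open>Around the points of an \<open>e\<close>-separated set, the balls of radius \<open>e/2\<close> are disjoint and have a
  common lower mass bound, so there are boundedly many of them; a separated set of maximal size is an
  \<open>e\<close>-net.\<close>

lemma compact_if_doubling_measure:
  fixes S :: "'a::complete_space set"
  assumes D: "doubling_measure S \<mu> C\<^sub>d" and Q: "C\<^sub>d = 2 powr Q" "Q \<ge> 0"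
    and S: "closed S" "bounded S" "S \<noteq> {}"
  shows "compact S"
  unfolding compact_eq_totally_bounded
proof (intro conjI allI impI)
  show "complete S" using S by (simp add: complete_eq_closed)
next
  fix e :: real assume e: "e > 0"
  interpret finite_measure \<mu> using finite_doubling_measure[OF D S(2,3)] .
  obtain R0 where R0: "\<And>y z. y \<in> S \<Longrightarrow> z \<in> S \<Longrightarrow> dist y z \<le> R0"
    using S(2) by (auto simp: bounded_two_points)
  define R where "R = max R0 0 + 1"
  have R: "dist y z < R" if "y \<in> S" "z \<in> S" for y z using R0[OF that] by (auto simp: R_def)
  have Rpos: "R > 0" by (simp add: R_def)
  define r where "r = min (e / 2) R"
  have r: "0 < r" "r \<le> R" "r \<le> e / 2" using e Rpos by (auto simp: r_def)
  define K where "K = (2 * R / r) powr Q"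
  have low: "measure \<mu> S \<le> K * measure \<mu> (rel_ball S x r)" if "x \<in> S" for x
    unfolding K_def by (rule doubling_measure_lower_bound[OF D Q R that r(1,2)])
  have mS: "measure \<mu> S > 0"
  proof -
    obtain x where x: "x \<in> S" using S by blast
    have "0 < measure \<mu> (rel_ball S x 1)" by (rule doubling_measure_measure(1)[OF D x]) simp
    also have "\<dots> \<le> measure \<mu> S" by (rule finite_measure_mono) (use sets.top[of \<mu>] doubling_measure_space[OF D] in auto)
    finally show ?thesis .
  qed
  define sep where "sep F \<longleftrightarrow> finite F \<and> F \<subseteq> S \<and> (\<forall>x\<in>F. \<forall>y\<in>F. x \<noteq> y \<longrightarrow> e \<le> dist x y)" for F
  have bound: "real (card F) \<le> K" if "sep F" for F
  proof -
    have F: "finite F" "F \<subseteq> S" using that by (auto simp: sep_def)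
    have "dist x y < e" if "z \<in> rel_ball S x r \<inter> rel_ball S y r" for x y z
      using that r(3) dist_triangle[of x y z] by (auto simp: dist_commute)
    then have disj: "disjoint_family_on (\<lambda>x. rel_ball S x r) F"
      using \<open>sep F\<close> unfolding disjoint_family_on_def sep_def by (meson disjoint_iff IntI not_le)
    have "real (card F) * measure \<mu> S = (\<Sum>x\<in>F. measure \<mu> S)" by simp
    also have "\<dots> \<le> (\<Sum>x\<in>F. K * measure \<mu> (rel_ball S x r))" using low F by (intro sum_mono) auto
    also have "\<dots> = K * measure \<mu> (\<Union>x\<in>F. rel_ball S x r)"
      unfolding sum_distrib_left[symmetric]
      by (subst finite_measure_finite_Union[OF F(1) _ disj]) (use doubling_measure_sets[OF D] in auto)
    also have "\<dots> \<le> K * measure \<mu> S"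
      by (intro mult_left_mono finite_measure_mono)
        (use sets.top[of \<mu>] doubling_measure_space[OF D] in \<open>auto simp: K_def\<close>)
    finally show ?thesis using mS by simp
  qed
  have "\<forall>F. sep F \<longrightarrow> card F < Suc (nat \<lceil>K\<rceil>)"
    using bound by (metis le_imp_less_Suc of_nat_ceiling order.trans of_nat_le_iff real_nat_ceiling_ge)
  moreover have "sep {}" by (simp add: sep_def)
  ultimately obtain F where F: "sep F" "\<And>F'. sep F' \<Longrightarrow> card F' \<le> card F"
    using ex_has_greatest_nat[of sep "{}" card] by blast
  have "S \<subseteq> (\<Union>x\<in>F. ball x e)"
  proof
    fix y assume y: "y \<in> S"
    show "y \<in> (\<Union>x\<in>F. ball x e)"
    proof (rule ccontr)
      assume "\<not> ?thesis"
      then have far: "e \<le> dist x y" if "x \<in> F" for x using that by (force simp: not_le)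
      then have "y \<notin> F" using e by force
      moreover have "sep (insert y F)" using F(1) y far by (auto simp: sep_def dist_commute)
      ultimately show False using F(2)[of "insert y F"] F(1) by (simp add: sep_def)
    qed
  qed
  then show "\<exists>k. finite k \<and> S \<subseteq> (\<Union>x\<in>k. ball x e)" using F(1) by (auto simp: sep_def)
qed

section \<open>A Lipschitz majorant of the cost function\<close>

text \<open>Finite Borel measures on metric spaces are regular with respect to closed and open sets: the sets
  that can be approximated form a sigma-algebra that contains the open sets.\<close>

lemma closed_open_approximation:
  fixes S :: "'a::metric_space set"
  assumes "finite_measure \<mu>" and sets: "sets \<mu> = sets (restrict_space borel S)"
    and B: "B \<in> sets borel" and "e > 0"
  shows "\<exists>K V. closed K \<and> open V \<and> K \<subseteq> B \<and> B \<subseteq> V \<and> measure \<mu> (S \<inter> (V - K)) < e"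
proof -
  interpret finite_measure \<mu> by fact
  have sS: "S \<inter> A \<in> sets \<mu>" if "A \<in> sets borel" for A
    using that by (auto simp: sets sets_restrict_space)
  have decr: "\<exists>n. measure \<mu> (S \<inter> D n) < d"
    if D: "\<And>n::nat. D n \<in> sets borel" "\<And>n. D (Suc n) \<subseteq> D n" "measure \<mu> (S \<inter> (\<Inter>n. D n)) < d" for D d
  proof -
    have "(\<lambda>n. measure \<mu> (S \<inter> D n)) \<longlonglongrightarrow> measure \<mu> (\<Inter>n. S \<inter> D n)"
      by (rule finite_Lim_measure_decseq) (use D sS in \<open>auto intro!: decseq_SucI\<close>)
    moreover have "(\<Inter>n. S \<inter> D n) = S \<inter> (\<Inter>n. D n)" by auto
    ultimately have "\<forall>\<^sub>F n in sequentially. measure \<mu> (S \<inter> D n) < d"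
      using D(3) by (auto dest: order_tendstoD)
    then show ?thesis by (meson eventually_happens sequentially_bot)
  qed
  have "B \<in> sigma_sets UNIV {U. open U}" using B by (simp add: borel_def)
  then show ?thesis using \<open>e > 0\<close>
  proof (induction arbitrary: e rule: sigma_sets.induct)
    case (Basic U)
    then have U: "open U" by simp
    show ?case
    proof (cases "U = UNIV")
      case True
      then show ?thesis using Basic by (intro exI[of _ UNIV]) auto
    next
      case False
      define K where "K n = {x. infdist x (- U) \<ge> inverse (real (Suc n))}" for n
      have cK: "closed (K n)" for n
        unfolding K_def by (intro closed_Collect_le continuous_intros)
      have empty: "(\<Inter>n. U - K n) = {}"
      proof (rule ccontr)
        assume "\<not> ?thesis"
        then obtain x where "\<forall>n. x \<in> U - K n" by blast
        then have x: "x \<in> U" "\<And>n. infdist x (- U) < inverse (real (Suc n))"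
          by (auto simp: K_def not_le)
        have "infdist x (- U) > 0"
          using x(1) U False by (intro infdist_pos_not_in_closed) auto
        then show False using reals_Archimedean[of "infdist x (- U)"] x(2) by (meson less_asym)
      qed
      have "\<exists>n. measure \<mu> (S \<inter> (U - K n)) < e"
      proof (intro decr)
        show "measure \<mu> (S \<inter> (\<Inter>n. U - K n)) < e"
          unfolding empty using Basic by simp
        show "U - K (Suc n) \<subseteq> U - K n" for n
        proof -
          have "inverse (real (Suc (Suc n))) \<le> inverse (real (Suc n))" by (simp add: field_simps)
          then have "x \<in> K (Suc n)" if "x \<in> K n" for x
            using that unfolding K_def mem_Collect_eq by linarith
          then show ?thesis by blast
        qed
      qed (use U cK in auto)
      then obtain n where "measure \<mu> (S \<inter> (U - K n)) < e" by blast
      moreover have "K n \<subseteq> U"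
      proof
        fix x assume "x \<in> K n"
        then have "infdist x (- U) > 0" unfolding K_def by (auto intro: less_le_trans[rotated])
        then show "x \<in> U" by (metis ComplI infdist_zero less_irrefl)
      qed
      ultimately show ?thesis using cK U by blast
    qed
  next
    case Empty
    then show ?case by (intro exI[of _ "{}"]) auto
  next
    case (Compl A)
    from Compl.IH[OF Compl.prems] obtain K V
      where "closed K" "open V" "K \<subseteq> A" "A \<subseteq> V" "measure \<mu> (S \<inter> (V - K)) < e"
      by (elim exE conjE)
    moreover have "- K - (- V) = V - K" by auto
    ultimately show ?case
      by (intro exI[of _ "- V"] exI[of _ "- K"]) (auto simp: open_Compl closed_Compl)
  next
    case (Union A)
    have "\<exists>K V. closed K \<and> open V \<and> K \<subseteq> A i \<and> A i \<subseteq> V \<and> measure \<mu> (S \<inter> (V - K)) < e / 2 * (1 / 2) ^ Suc i" for i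
      using Union.IH[of "e / 2 * (1 / 2) ^ Suc i"] Union.prems by simp
    then obtain K V where KV: "\<And>i. closed (K i)" "\<And>i. open (V i)" "\<And>i. K i \<subseteq> A i" "\<And>i. A i \<subseteq> V i"
      and m: "\<And>i. measure \<mu> (S \<inter> (V i - K i)) < e / 2 * (1 / 2) ^ Suc i"
      by metis
    have meas: "S \<inter> (V i - K i) \<in> sets \<mu>" for i using KV by (intro sS) auto
    have sm: "(\<lambda>i. e / 2 * (1 / 2) ^ Suc i) sums (e / 2 * 1)"
      by (intro sums_mult power_half_series)
    have sm': "summable (\<lambda>i. measure \<mu> (S \<inter> (V i - K i)))"
      by (rule summable_comparison_test[OF _ sums_summable[OF sm]]) (use m less_imp_le in auto)
    have "measure \<mu> (S \<inter> ((\<Union>i. V i) - (\<Union>i. K i))) \<le> measure \<mu> (\<Union>i. S \<inter> (V i - K i))"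
      by (rule finite_measure_mono, blast, rule sets.countable_UN) (use meas in auto)
    also have "\<dots> \<le> (\<Sum>i. measure \<mu> (S \<inter> (V i - K i)))"
      by (rule finite_measure_subadditive_countably) (use meas sm' in auto)
    also have "\<dots> \<le> (\<Sum>i. e / 2 * (1 / 2) ^ Suc i)"
      by (rule suminf_le) (use m less_imp_le sm' sums_summable[OF sm] in auto)
    also have "\<dots> = e / 2" using sums_unique[OF sm] by simp
    also have "\<dots> < e" using Union.prems by simp
    finally have lt: "measure \<mu> (S \<inter> ((\<Union>i. V i) - (\<Union>i. K i))) < e" .
    have "(\<Inter>n. (\<Union>i. V i) - (\<Union>i\<le>n. K i)) = (\<Union>i. V i) - (\<Union>i. K i)" by auto
    then have "\<exists>n. measure \<mu> (S \<inter> ((\<Union>i. V i) - (\<Union>i\<le>n. K i))) < e"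
      by (intro decr) (use KV lt in \<open>auto intro!: sets.Diff borel_open borel_closed closed_UN\<close>)
    then obtain n where "measure \<mu> (S \<inter> ((\<Union>i. V i) - (\<Union>i\<le>n. K i))) < e" by blast
    moreover have "closed (\<Union>i\<le>n. K i)" using KV(1) by (intro closed_UN) auto
    moreover have "open (\<Union>i. V i)" using KV(2) by (intro open_UN) auto
    moreover have "(\<Union>i\<le>n. K i) \<subseteq> \<Union> (range A)" using KV(3) by blast
    moreover have "\<Union> (range A) \<subseteq> (\<Union>i. V i)" using KV(4) by blast
    ultimately show ?case by (intro exI conjI)
  qed
qed

text \<open>This is the Vitali-Caratheodory theorem with the lower semicontinuous majorant replaced by the
  sequence of Lipschitz functions that it is the supremum of. Since \<open>h\<close> is at most the number of \<open>k\<close> with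
  \<open>h > k\<close>, it suffices to enclose each of these level sets in an open set of almost the same measure and to
  approximate the indicator function of that open set from below.\<close>

lemma lipschitz_sequence_above:
  fixes S :: "'a::metric_space set"
  assumes fin: "finite_measure \<mu>" and sets: "sets \<mu> = sets (restrict_space borel S)"
    and h: "integrable \<mu> h" "\<And>z. z \<in> S \<Longrightarrow> 0 \<le> h z"
  shows "\<exists>(H :: nat \<Rightarrow> 'a \<Rightarrow> real) L A. (\<forall>n. (L n)-lipschitz_on UNIV (H n)) \<and>
    (\<forall>n z. 1 \<le> H n z \<and> H n z \<le> 1 + real n) \<and> (\<forall>m n z. m \<le> n \<longrightarrow> H m z \<le> H n z) \<and>
    (\<forall>z\<in>S. \<exists>n. h z \<le> H n z) \<and> 0 \<le> A \<and> (\<forall>n. (\<integral>\<^sup>+ z. ennreal (H n z) \<partial>\<mu>) \<le> ennreal A)"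
proof -
  interpret finite_measure \<mu> by fact
  have sp: "space \<mu> = S"
    using sets_eq_imp_space_eq[OF sets] by (simp add: space_restrict_space)
  have sS: "S \<inter> A \<in> sets \<mu>" if "A \<in> sets borel" for A
    using that by (auto simp: sets sets_restrict_space)
  define E where "E k = {z \<in> S. real k < h z}" for k
  have Es: "E k \<in> sets \<mu>" for k
  proof -
    have "h \<in> borel_measurable \<mu>" using h(1) by simp
    then have "{z \<in> space \<mu>. real k < h z} \<in> sets \<mu>" by measurable
    then show ?thesis by (simp add: E_def sp)
  qed
  have "\<exists>V. open V \<and> E k \<subseteq> V \<and> measure \<mu> (S \<inter> V) \<le> measure \<mu> (E k) + (1 / 2) ^ k" for k
  proof -
    obtain B where B: "B \<in> sets borel" "E k = S \<inter> B" using Es[of k] by (auto simp: sets sets_restrict_space)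
    obtain K V where KV: "closed K" "open V" "K \<subseteq> B" "B \<subseteq> V" "measure \<mu> (S \<inter> (V - K)) < (1 / 2) ^ k"
      using closed_open_approximation[OF fin sets B(1), of "(1 / 2) ^ k"] by auto
    have "measure \<mu> (S \<inter> V) \<le> measure \<mu> (E k \<union> S \<inter> (V - K))"
      by (rule finite_measure_mono) (use KV Es B sS in auto)
    also have "\<dots> \<le> measure \<mu> (E k) + measure \<mu> (S \<inter> (V - K))"
      by (rule measure_Un_le) (use KV Es sS in auto)
    finally show ?thesis using KV B by (intro exI[of _ V]) auto
  qed
  then obtain V where V: "\<And>k. open (V k)" "\<And>k. E k \<subseteq> V k"
    and mV: "\<And>k. measure \<mu> (S \<inter> V k) \<le> measure \<mu> (E k) + (1 / 2) ^ k"
    by metis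
  \<comment> \<open>\<open>infdist\<close> to the empty set is 0, which is the wrong value here.\<close>
  define \<phi> where "\<phi> k n z = (if V k = UNIV then 1 else min 1 (real n * infdist z (- V k)))" for k n z
  have \<phi>01: "0 \<le> \<phi> k n z" "\<phi> k n z \<le> 1" for k n z by (auto simp: \<phi>_def infdist_nonneg)
  have \<phi>V: "\<phi> k n z \<le> indicator (V k) z" for k n z
    using \<phi>01[of k n z] by (auto simp: \<phi>_def indicator_def)
  have \<phi>lip: "\<bar>\<phi> k n y - \<phi> k n z\<bar> \<le> real n * dist y z" for k n y z
  proof -
    have "\<bar>real n * infdist y (- V k) - real n * infdist z (- V k)\<bar> \<le> real n * dist y z"
      unfolding right_diff_distrib[symmetric] abs_mult
      using infdist_triangle_abs[of y "- V k" z] by (simp add: mult_left_mono)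
    then show ?thesis by (auto simp: \<phi>_def)
  qed
  have \<phi>mono: "\<phi> k m z \<le> \<phi> k n z" if "m \<le> n" for k m n z
  proof -
    have "real m * infdist z (- V k) \<le> real n * infdist z (- V k)"
      using that by (intro mult_right_mono infdist_nonneg) auto
    then show ?thesis by (auto simp: \<phi>_def)
  qed
  have \<phi>1: "\<exists>n0. \<forall>n\<ge>n0. \<phi> k n z = 1" if "z \<in> V k" for k z
  proof (cases "V k = UNIV")
    case False
    then have pos: "infdist z (- V k) > 0"
      using that V(1) by (intro infdist_pos_not_in_closed) auto
    obtain n0 where n0: "1 / infdist z (- V k) \<le> real n0" using real_arch_simple by blast
    have "\<phi> k n z = 1" if "n \<ge> n0" for n
    proof -
      have "1 / infdist z (- V k) \<le> real n" using n0 that by linarith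
      then have "1 \<le> real n * infdist z (- V k)" using pos by (simp add: field_simps)
      then show ?thesis using False by (simp add: \<phi>_def)
    qed
    then show ?thesis by blast
  qed (simp add: \<phi>_def)
  define H where "H n z = 1 + (\<Sum>k<n. \<phi> k n z)" for n z
  define L where "L n = real n * real n" for n
  define A where "A = 2 * measure \<mu> S + (LINT z|\<mu>. h z) + 2"
  have "(L n)-lipschitz_on UNIV (H n)" for n
  proof (rule lipschitz_onI)
    fix y z
    have "dist (H n y) (H n z) = \<bar>\<Sum>k<n. \<phi> k n y - \<phi> k n z\<bar>"
      by (simp add: H_def dist_real_def sum_subtractf)
    also have "\<dots> \<le> (\<Sum>k<n. real n * dist y z)"
      by (rule order.trans[OF sum_abs]) (intro sum_mono \<phi>lip)
    finally show "dist (H n y) (H n z) \<le> L n * dist y z" by (simp add: L_def)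
  qed (simp add: L_def)
  moreover have "1 \<le> H n z" "H n z \<le> 1 + real n" for n z
    using sum_mono[of "{..<n}" "\<lambda>k. \<phi> k n z" "\<lambda>_. 1"] \<phi>01 by (auto simp: H_def intro: sum_nonneg)
  moreover have "H m z \<le> H n z" if "m \<le> n" for m n z
  proof -
    have "(\<Sum>k<m. \<phi> k m z) \<le> (\<Sum>k<m. \<phi> k n z)" by (intro sum_mono \<phi>mono that)
    also have "\<dots> \<le> (\<Sum>k<n. \<phi> k n z)" using that \<phi>01 by (intro sum_mono2) auto
    finally show ?thesis by (simp add: H_def)
  qed
  moreover have "\<exists>n. h z \<le> H n z" if z: "z \<in> S" for z
  proof -
    define N where "N = nat \<lceil>h z\<rceil>"
    have "z \<in> V k" if "k < N" for k
    proof -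
      have "real k < h z" using that unfolding N_def by linarith
      then show ?thesis using z V(2) by (auto simp: E_def)
    qed
    then have "\<forall>k\<in>{..<N}. \<exists>n0. \<forall>n\<ge>n0. \<phi> k n z = 1" using \<phi>1 by blast
    then have "\<forall>\<^sub>F n in sequentially. \<forall>k\<in>{..<N}. \<phi> k n z = 1"
      by (intro eventually_ball_finite) (auto simp: eventually_sequentially)
    then have "\<forall>\<^sub>F n in sequentially. (\<forall>k\<in>{..<N}. \<phi> k n z = 1) \<and> N \<le> n"
      using eventually_ge_at_top eventually_conj by blast
    from eventually_happens'[OF sequentially_bot this]
    obtain n where n: "\<forall>k\<in>{..<N}. \<phi> k n z = 1" "N \<le> n" by (elim exE conjE)
    have "h z \<le> real N" unfolding N_def by (rule real_nat_ceiling_ge)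
    also have "\<dots> = (\<Sum>k<N. \<phi> k n z)" using n by simp
    also have "\<dots> \<le> (\<Sum>k<n. \<phi> k n z)" using n \<phi>01 by (intro sum_mono2) auto
    finally show ?thesis by (intro exI[of _ n]) (simp add: H_def)
  qed
  moreover have int0: "0 \<le> (LINT z|\<mu>. h z)"
    using h sp by (intro integral_nonneg_AE) auto
  then have "0 \<le> A" by (simp add: A_def)
  moreover have "(\<integral>\<^sup>+ z. ennreal (H n z) \<partial>\<mu>) \<le> ennreal A" for n
  proof -
    have levels: "(\<Sum>k<n. measure \<mu> (E k)) \<le> (LINT z|\<mu>. h z) + measure \<mu> S"
    proof -
      have "(\<Sum>k<n. measure \<mu> (E k)) = (LINT z|\<mu>. (\<Sum>k<n. indicator (E k) z))"
        using Es by (subst Bochner_Integration.integral_sum) (auto simp: emeasure_eq_measure)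
      also have "\<dots> \<le> (LINT z|\<mu>. h z + 1)"
      proof (rule integral_mono)
        show "integrable \<mu> (\<lambda>z. \<Sum>k<n. indicator (E k) z :: real)"
          using Es by (intro Bochner_Integration.integrable_sum) (auto simp: emeasure_eq_measure)
        show "integrable \<mu> (\<lambda>z. h z + 1)" using h(1) by simp
        fix z assume "z \<in> space \<mu>"
        then have z: "z \<in> S" by (simp add: sp)
        have "{..<n} \<inter> {k. z \<in> E k} \<subseteq> {..<nat \<lceil>h z\<rceil>}"
        proof
          fix k assume "k \<in> {..<n} \<inter> {k. z \<in> E k}"
          then have "real k < h z" by (simp add: E_def)
          then have "int k < \<lceil>h z\<rceil>" by (simp add: less_ceiling_iff)
          then show "k \<in> {..<nat \<lceil>h z\<rceil>}" by simp
        qed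
        then have "card ({..<n} \<inter> {k. z \<in> E k}) \<le> card {..<nat \<lceil>h z\<rceil>}" by (intro card_mono) auto
        moreover have "(\<Sum>k<n. indicator (E k) z :: real) = real (card ({..<n} \<inter> {k. z \<in> E k}))"
          by (simp add: indicator_def sum.If_cases)
        moreover have "real (nat \<lceil>h z\<rceil>) \<le> h z + 1" using h(2)[OF z] by linarith
        ultimately show "(\<Sum>k<n. indicator (E k) z :: real) \<le> h z + 1" by simp
      qed
      also have "\<dots> = (LINT z|\<mu>. h z) + measure \<mu> S"
        using h(1) by (subst Bochner_Integration.integral_add) (auto simp: sp)
      finally show ?thesis .
    qed
    have geo: "(\<Sum>k<n. (1 / 2) ^ k) \<le> (2::real)"
      by (subst sum_gp_strict) simp
    have mSV: "S \<inter> V k \<in> sets \<mu>" for k using V(1) by (intro sS) auto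
    have "(\<integral>\<^sup>+ z. ennreal (H n z) \<partial>\<mu>) \<le> (\<integral>\<^sup>+ z. 1 + (\<Sum>k<n. indicator (S \<inter> V k) z) \<partial>\<mu>)"
    proof (rule nn_integral_mono)
      fix z assume "z \<in> space \<mu>"
      then have z: "z \<in> S" by (simp add: sp)
      have "H n z \<le> 1 + (\<Sum>k<n. indicator (V k) z)"
        unfolding H_def by (intro add_left_mono sum_mono \<phi>V)
      then have "ennreal (H n z) \<le> ennreal (1 + (\<Sum>k<n. indicator (V k) z))" by (rule ennreal_leI)
      also have "\<dots> = 1 + (\<Sum>k<n. ennreal (indicator (V k) z))"
        by (simp add: sum_nonneg sum_ennreal)
      also have "\<dots> = 1 + (\<Sum>k<n. indicator (S \<inter> V k) z)"
        using z by (intro arg_cong2[of _ _ _ _ "(+)"] sum.cong refl) (auto simp: indicator_def)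
      finally show "ennreal (H n z) \<le> 1 + (\<Sum>k<n. indicator (S \<inter> V k) z)" .
    qed
    also have "\<dots> = emeasure \<mu> S + (\<Sum>k<n. emeasure \<mu> (S \<inter> V k))"
      using mSV sp by (subst nn_integral_add) (auto simp: nn_integral_sum)
    also have "\<dots> = ennreal (measure \<mu> S + (\<Sum>k<n. measure \<mu> (S \<inter> V k)))"
      by (simp add: emeasure_eq_measure sum_nonneg sum_ennreal)
    also have "\<dots> \<le> ennreal A"
    proof (rule ennreal_leI)
      have "(\<Sum>k<n. measure \<mu> (S \<inter> V k)) \<le> (\<Sum>k<n. measure \<mu> (E k)) + (\<Sum>k<n. (1 / 2) ^ k)"
        unfolding sum.distrib[symmetric] by (intro sum_mono mV)
      then show "measure \<mu> S + (\<Sum>k<n. measure \<mu> (S \<inter> V k)) \<le> A"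
        using levels geo by (simp add: A_def)
    qed
    finally show ?thesis .
  qed
  ultimately show ?thesis
    by (intro exI[of _ H] exI[of _ L] exI[of _ A]) blast
qed

text \<open>On \<open>[1, \<infinity>)\<close> the \<open>q\<close>-th power is 1-Lipschitz, since \<open>(b/a)\<^sup>q \<le> b/a\<close> there. This is why the
  functions above are kept at least 1: their \<open>p\<close>-th roots are then Lipschitz, too.\<close>

lemma powr_diff_le:
  fixes a b q :: real
  assumes "1 \<le> a" "a \<le> b" "0 < q" "q \<le> 1"
  shows "b powr q - a powr q \<le> b - a"
proof -
  have "b powr q = a powr q * (b / a) powr q" using assms by (simp add: powr_divide)
  also have "(b / a) powr q \<le> (b / a) powr 1" using assms by (intro powr_mono) auto
  finally have "b powr q - a powr q \<le> a powr q * (b / a - 1)"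
    using assms by (simp add: algebra_simps mult_left_mono)
  also have "\<dots> \<le> a powr 1 * (b / a - 1)"
    using assms by (intro mult_right_mono powr_mono) auto
  also have "\<dots> = b - a" using assms by (simp add: field_simps)
  finally show ?thesis .
qed

lemma lipschitz_sequence_above_powr:
  fixes S :: "'a::metric_space set"
  assumes fin: "finite_measure \<mu>" and sets: "sets \<mu> = sets (restrict_space borel S)" and p: "p > 1"
    and f: "integrable \<mu> (\<lambda>z. \<bar>f z\<bar> powr p)"
  shows "\<exists>(g :: nat \<Rightarrow> 'a \<Rightarrow> real) L A. (\<forall>n. (L n)-lipschitz_on S (g n)) \<and>
    (\<forall>n z. 1 \<le> g n z \<and> g n z \<le> 1 + real n) \<and> (\<forall>m n z. m \<le> n \<longrightarrow> g m z \<le> g n z) \<and>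
    (\<forall>z\<in>S. \<exists>n. f z \<le> g n z) \<and> 0 \<le> A \<and>
    (\<forall>n. (\<integral>\<^sup>+ z. ennreal_powr (ennreal (g n z)) p \<partial>\<mu>) \<le> ennreal A)"
proof -
  obtain H :: "nat \<Rightarrow> 'a \<Rightarrow> real" and L A where H: "\<And>n. (L n)-lipschitz_on UNIV (H n)"
    "\<And>n z. 1 \<le> H n z" "\<And>n z. H n z \<le> 1 + real n" "\<And>m n z. m \<le> n \<Longrightarrow> H m z \<le> H n z"
    "\<And>z. z \<in> S \<Longrightarrow> \<exists>n. \<bar>f z\<bar> powr p \<le> H n z" "0 \<le> A"
    "\<And>n. (\<integral>\<^sup>+ z. ennreal (H n z) \<partial>\<mu>) \<le> ennreal A"
    using lipschitz_sequence_above[OF fin sets f] by (auto simp: ) metis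
  define q where "q = 1 / p"
  have q: "0 < q" "q \<le> 1" "q * p = 1" using p by (auto simp: q_def)
  define g where "g n z = H n z powr q" for n z
  have "(L n)-lipschitz_on S (g n)" for n
  proof (rule lipschitz_onI)
    show "0 \<le> L n" using H(1) by (rule lipschitz_on_nonneg)
    fix y z assume "y \<in> S" "z \<in> S"
    have "dist (g n y) (g n z) \<le> dist (H n y) (H n z)"
      using powr_diff_le[OF H(2)[of n y] _ q(1,2), of "H n z"] powr_diff_le[OF H(2)[of n z] _ q(1,2), of "H n y"]
        powr_mono2[of q "H n y" "H n z"] powr_mono2[of q "H n z" "H n y"] H(2)[of n y] H(2)[of n z] q
      by (cases "H n y \<le> H n z") (auto simp: g_def dist_real_def)
    also have "\<dots> \<le> L n * dist y z" by (rule lipschitz_onD[OF H(1)]) auto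
    finally show "dist (g n y) (g n z) \<le> L n * dist y z" .
  qed
  moreover have "1 \<le> g n z" "g n z \<le> 1 + real n" for n z
  proof -
    show "1 \<le> g n z" unfolding g_def using H(2) q by (intro ge_one_powr_ge_zero) auto
    have "g n z \<le> H n z powr 1" unfolding g_def using H(2) q by (intro powr_mono) auto
    then show "g n z \<le> 1 + real n" using H(2,3)[of n z] by simp
  qed
  moreover have "g m z \<le> g n z" if "m \<le> n" for m n z
    unfolding g_def using H(2)[of m z] H(4)[OF that, of z] q by (intro powr_mono2) auto
  moreover have "\<exists>n. f z \<le> g n z" if "z \<in> S" for z
  proof -
    obtain n where "\<bar>f z\<bar> powr p \<le> H n z" using H(5) \<open>z \<in> S\<close> by blast
    then have "(\<bar>f z\<bar> powr p) powr q \<le> H n z powr q" using q by (intro powr_mono2) auto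
    moreover have "(\<bar>f z\<bar> powr p) powr q = \<bar>f z\<bar>" using q by (simp add: powr_powr mult.commute)
    ultimately show ?thesis by (intro exI[of _ n]) (simp add: g_def)
  qed
  moreover have "ennreal_powr (ennreal (g n z)) p = ennreal (H n z)" for n z
    using H(2)[of n z] q by (simp add: ennreal_powr_def g_def powr_powr)
  ultimately show ?thesis
    using H(6,7) by (intro exI[of _ g] exI[of _ L] exI[of _ A]) auto
qed

section \<open>Hoelder continuity from the Poincare inequality\<close>

lemma mean_value_diff_le:
  assumes fin: "finite_measure \<mu>" and w: "integrable \<mu> w"
    and B: "B' \<subseteq> B" "B' \<in> sets \<mu>" "B \<in> sets \<mu>" and pos: "measure \<mu> B' > 0"
  shows "measure \<mu> B' * \<bar>mean_value \<mu> B' w - c\<bar> \<le> (LINT z:B|\<mu>. \<bar>w z - c\<bar>)"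
proof -
  interpret finite_measure \<mu> by fact
  have i: "integrable \<mu> (\<lambda>z. w z - c)" using w by simp
  have iA: "set_integrable \<mu> A (\<lambda>z. w z - c)" if "A \<in> sets \<mu>" for A
    unfolding set_integrable_def using integrable_mult_indicator[OF that i] .
  have iA': "set_integrable \<mu> A (\<lambda>z. \<bar>w z - c\<bar>)" if "A \<in> sets \<mu>" for A
    unfolding set_integrable_def using integrable_mult_indicator[OF that] i by blast
  have "measure \<mu> B' * (mean_value \<mu> B' w - c) = (LINT z:B'|\<mu>. w z) - c * measure \<mu> B'"
    using pos by (simp add: mean_value_def field_simps)
  also have "\<dots> = (LINT z:B'|\<mu>. w z - c)"
    unfolding set_lebesgue_integral_def
    using B(2) integrable_mult_indicator[OF B(2) w]
    by (simp add: right_diff_distrib Bochner_Integration.integral_diff emeasure_eq_measure)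
  finally have "\<bar>measure \<mu> B' * (mean_value \<mu> B' w - c)\<bar> = \<bar>LINT z:B'|\<mu>. w z - c\<bar>"
    by (rule arg_cong)
  then have "measure \<mu> B' * \<bar>mean_value \<mu> B' w - c\<bar> = \<bar>LINT z:B'|\<mu>. w z - c\<bar>"
    by (simp add: abs_mult)
  also have "\<dots> \<le> (LINT z:B'|\<mu>. \<bar>w z - c\<bar>)"
    unfolding set_lebesgue_integral_def
    using integral_norm_bound[of \<mu> "\<lambda>z. indicator B' z *\<^sub>R (w z - c)"] by (simp add: abs_mult)
  also have "\<dots> \<le> (LINT z:B|\<mu>. \<bar>w z - c\<bar>)"
    unfolding set_lebesgue_integral_def
    by (rule integral_mono)
      (use iA'[OF B(2)] iA'[OF B(3)] B(1) in \<open>auto simp: set_integrable_def indicator_def\<close>)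
  finally show ?thesis .
qed

lemma ennreal_powr_le:
  assumes "a \<le> ennreal b" "0 \<le> b" "0 < q"
  shows "ennreal_powr a q \<le> ennreal (b powr q)"
proof -
  have "a \<noteq> \<infinity>" using assms(1) by (auto simp: top_unique)
  moreover have "enn2real a \<le> b" using assms by (intro enn2real_leI) auto
  ultimately show ?thesis
    unfolding ennreal_powr_def using assms by (auto intro!: ennreal_leI powr_mono2)
qed

lemma diameter_rel_ball_le:
  assumes "x \<in> S" "r > 0"
  shows "diameter (rel_ball S x r) \<le> 2 * r"
proof -
  have "(SUP (y, z) \<in> rel_ball S x r \<times> rel_ball S x r. dist y z) \<le> 2 * r"
  proof (rule cSUP_least)
    have "x \<in> rel_ball S x r" using assms by simp
    then show "rel_ball S x r \<times> rel_ball S x r \<noteq> {}" by blast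
  next
    fix u assume "u \<in> rel_ball S x r \<times> rel_ball S x r"
    then obtain y z where u: "u = (y, z)" "dist x y < r" "dist x z < r" by auto
    then show "(case u of (y, z) \<Rightarrow> dist y z) \<le> 2 * r"
      using dist_triangle3[of y z x] by simp
  qed
  then show ?thesis using assms by (auto simp: diameter_def)
qed

text \<open>On a ball of radius \<open>r\<close>, the mass bound \<open>\<mu> B \<ge> c r\<^sup>Q\<close> turns the right-hand side of the
  Poincare inequality into a multiple of \<open>r\<^bsup>1 - Q/p\<^esup>\<close>.\<close>

lemma mean_oscillation_le:
  assumes D: "doubling_measure S \<mu> C\<^sub>d" and Q: "C\<^sub>d = 2 powr Q" "Q \<ge> 0"
    and fin: "finite_measure \<mu>"
    and R: "\<And>y z. y \<in> S \<Longrightarrow> z \<in> S \<Longrightarrow> dist y z < R"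
    and p: "p > 0" and A: "A \<ge> 0" and C: "C > 0" and \<Lambda>: "\<Lambda> \<ge> 1"
    and P: "(\<integral>\<^sup>+ z \<in> rel_ball S x r. ennreal \<bar>w z - mean_value \<mu> (rel_ball S x r) w\<bar> \<partial>\<mu>)
            / emeasure \<mu> (rel_ball S x r)
          \<le> ennreal (C * diameter (rel_ball S x r)) *
             ennreal_powr
               ((\<integral>\<^sup>+ z \<in> rel_ball S x (\<Lambda> * r). ennreal_powr (\<rho> z) p \<partial>\<mu>)
                  / emeasure \<mu> (rel_ball S x (\<Lambda> * r))) (1 / p)"
    and \<rho>: "(\<integral>\<^sup>+ z. ennreal_powr (\<rho> z) p \<partial>\<mu>) \<le> ennreal A"
    and w: "integrable \<mu> w" and x: "x \<in> S" and r: "0 < r" "r \<le> R"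
  shows "(LINT z:rel_ball S x r|\<mu>. \<bar>w z - mean_value \<mu> (rel_ball S x r) w\<bar>)
    \<le> 2 * C * (A * (2 * R) powr Q / measure \<mu> S) powr (1 / p) * r powr (1 - Q / p)
        * measure \<mu> (rel_ball S x r)"
proof -
  interpret finite_measure \<mu> by fact
  define B where "B = rel_ball S x r"
  define c where "c = mean_value \<mu> B w"
  define A' where "A' = A * (2 * R) powr Q / measure \<mu> S"
  define m where "m = measure \<mu> B"
  have Bs: "B \<in> sets \<mu>" unfolding B_def by (rule doubling_measure_sets[OF D]) simp
  have m: "m > 0" unfolding m_def B_def by (rule doubling_measure_measure(1)[OF D x r(1)])
  have mS: "measure \<mu> S > 0"
  proof -
    have "m \<le> measure \<mu> S" unfolding m_def
      by (rule finite_measure_mono) (use sets.top[of \<mu>] doubling_measure_space[OF D] in \<open>auto simp: B_def\<close>)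
    with m show ?thesis by simp
  qed
  have Rpos: "R > 0" using r by simp
  have low: "measure \<mu> S \<le> (2 * R / r) powr Q * m"
    unfolding m_def B_def by (rule doubling_measure_lower_bound[OF D Q R x r])
  have low': "A / m \<le> A' * r powr - Q"
  proof -
    have "measure \<mu> S * r powr Q \<le> (2 * R) powr Q * m"
      using low r Rpos by (simp add: powr_divide field_simps)
    then have "A * (measure \<mu> S * r powr Q) \<le> A * ((2 * R) powr Q * m)" using A by (rule mult_left_mono)
    then show ?thesis using m mS r by (simp add: A'_def powr_minus field_simps)
  qed
  have "(\<integral>\<^sup>+ z \<in> rel_ball S x (\<Lambda> * r). ennreal_powr (\<rho> z) p \<partial>\<mu>) \<le> (\<integral>\<^sup>+ z. ennreal_powr (\<rho> z) p \<partial>\<mu>)"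
    by (rule nn_integral_mono) (auto simp: indicator_def)
  also note \<rho>
  finally have num: "(\<integral>\<^sup>+ z \<in> rel_ball S x (\<Lambda> * r). ennreal_powr (\<rho> z) p \<partial>\<mu>) \<le> ennreal A" .
  have "r \<le> \<Lambda> * r" using \<Lambda> r by simp
  then have "B \<subseteq> rel_ball S x (\<Lambda> * r)" by (auto simp: B_def)
  then have "m \<le> measure \<mu> (rel_ball S x (\<Lambda> * r))"
    unfolding m_def by (rule finite_measure_mono) (rule doubling_measure_sets[OF D], simp)
  then have "inverse (emeasure \<mu> (rel_ball S x (\<Lambda> * r))) \<le> inverse (emeasure \<mu> B)"
    using m by (simp add: emeasure_eq_measure inverse_ennreal ennreal_leI le_imp_inverse_le flip: m_def)
  then have "(\<integral>\<^sup>+ z \<in> rel_ball S x (\<Lambda> * r). ennreal_powr (\<rho> z) p \<partial>\<mu>) / emeasure \<mu> (rel_ball S x (\<Lambda> * r))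
      \<le> ennreal A / emeasure \<mu> B"
    unfolding divide_ennreal_def by (intro mult_mono num) auto
  also have "\<dots> = ennreal (A / m)" using A m by (simp add: emeasure_eq_measure divide_ennreal m_def)
  also have "\<dots> \<le> ennreal (A' * r powr - Q)" using low' by (rule ennreal_leI)
  finally have quot: "ennreal_powr ((\<integral>\<^sup>+ z \<in> rel_ball S x (\<Lambda> * r). ennreal_powr (\<rho> z) p \<partial>\<mu>) / emeasure \<mu> (rel_ball S x (\<Lambda> * r))) (1 / p)
      \<le> ennreal ((A' * r powr - Q) powr (1 / p))"
    using A p by (intro ennreal_powr_le) (auto simp: A'_def)
  have pw: "(A' * r powr - Q) powr (1 / p) * r = A' powr (1 / p) * r powr (1 - Q / p)"
  proof -
    have "(A' * r powr - Q) powr (1 / p) = A' powr (1 / p) * r powr (- Q / p)"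
      using r by (simp add: powr_mult powr_powr)
    moreover have "r powr (1 - Q / p) = r powr (- Q / p) * r"
      using r powr_add[of r "- Q / p" 1] by (simp add: add.commute)
    ultimately show ?thesis by simp
  qed
  have "(\<integral>\<^sup>+ z \<in> B. ennreal \<bar>w z - c\<bar> \<partial>\<mu>) / emeasure \<mu> B
      \<le> ennreal (C * (2 * r)) * ennreal ((A' * r powr - Q) powr (1 / p))"
    unfolding B_def c_def
    by (rule order.trans[OF P]) (intro mult_mono quot ennreal_leI mult_left_mono diameter_rel_ball_le x r, use C in auto)
  also have "\<dots> = ennreal (2 * C * ((A' * r powr - Q) powr (1 / p) * r))"
    using C r by (simp add: ennreal_mult[symmetric] mult_ac)
  also have "\<dots> = ennreal (2 * C * A' powr (1 / p) * r powr (1 - Q / p))"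
    unfolding pw by (simp add: mult_ac)
  finally have main: "(\<integral>\<^sup>+ z \<in> B. ennreal \<bar>w z - c\<bar> \<partial>\<mu>) / ennreal m
      \<le> ennreal (2 * C * A' powr (1 / p) * r powr (1 - Q / p))"
    by (simp add: emeasure_eq_measure m_def)
  have int: "integrable \<mu> (\<lambda>z. indicator B z *\<^sub>R \<bar>w z - c\<bar>)"
    using integrable_mult_indicator[OF Bs, of "\<lambda>z. \<bar>w z - c\<bar>"] w by simp
  have "(\<integral>\<^sup>+ z \<in> B. ennreal \<bar>w z - c\<bar> \<partial>\<mu>) = (\<integral>\<^sup>+ z. ennreal (indicator B z *\<^sub>R \<bar>w z - c\<bar>) \<partial>\<mu>)"
    by (rule nn_integral_cong) (auto simp: indicator_def)
  also have "\<dots> = ennreal (LINT z:B|\<mu>. \<bar>w z - c\<bar>)"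
    unfolding set_lebesgue_integral_def by (rule nn_integral_eq_integral[OF int]) auto
  finally have "ennreal ((LINT z:B|\<mu>. \<bar>w z - c\<bar>) / m) \<le> ennreal (2 * C * A' powr (1 / p) * r powr (1 - Q / p))"
    using main m by (subst divide_ennreal[symmetric]) (auto simp: set_lebesgue_integral_def intro!: integral_nonneg_AE)
  then have "(LINT z:B|\<mu>. \<bar>w z - c\<bar>) / m \<le> 2 * C * A' powr (1 / p) * r powr (1 - Q / p)"
    using C by (subst (asm) ennreal_le_iff) auto
  then show ?thesis
    using m by (simp add: B_def c_def A'_def m_def pos_divide_le_eq)
qed

lemma mean_value_tendsto:
  assumes D: "doubling_measure S \<mu> C\<^sub>d" and fin: "finite_measure \<mu>"
    and w: "continuous_on S w" "integrable \<mu> w" and x: "x \<in> S"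
    and s: "s \<longlonglongrightarrow> 0" "\<And>i. s i > 0"
  shows "(\<lambda>i. mean_value \<mu> (rel_ball S x (s i)) w) \<longlonglongrightarrow> w x"
proof (rule metric_LIMSEQ_I)
  interpret finite_measure \<mu> by fact
  fix e :: real assume e: "e > 0"
  obtain d where d: "d > 0" "\<And>z. z \<in> S \<Longrightarrow> dist z x < d \<Longrightarrow> dist (w z) (w x) < e / 2"
    using w(1) x e unfolding continuous_on_iff by (metis half_gt_zero)
  obtain N where N: "\<And>i. i \<ge> N \<Longrightarrow> dist (s i) 0 < d" using metric_LIMSEQ_D[OF s(1) d(1)] by blast
  show "\<exists>no. \<forall>i\<ge>no. dist (mean_value \<mu> (rel_ball S x (s i)) w) (w x) < e"
  proof (intro exI[of _ N] allI impI)
    fix i assume i: "i \<ge> N"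
    define B where "B = rel_ball S x (s i)"
    have Bs: "B \<in> sets \<mu>" unfolding B_def by (rule doubling_measure_sets[OF D]) simp
    have m: "measure \<mu> B > 0" unfolding B_def by (rule doubling_measure_measure(1)[OF D x s(2)])
    have near: "\<bar>w z - w x\<bar> \<le> e / 2" if "z \<in> B" for z
      using d(2)[of z] N[OF i] s(2)[of i] that by (auto simp: B_def dist_real_def dist_commute)
    have "measure \<mu> B * \<bar>mean_value \<mu> B w - w x\<bar> \<le> (LINT z:B|\<mu>. \<bar>w z - w x\<bar>)"
      by (rule mean_value_diff_le[OF fin w(2) order_refl Bs Bs m])
    also have "\<dots> \<le> (LINT z:B|\<mu>. e / 2)"
      unfolding set_lebesgue_integral_def
    proof (rule integral_mono)
      show "integrable \<mu> (\<lambda>z. indicator B z *\<^sub>R \<bar>w z - w x\<bar>)"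
        using integrable_mult_indicator[OF Bs, of "\<lambda>z. \<bar>w z - w x\<bar>"] w(2) by simp
      show "integrable \<mu> (\<lambda>z. indicator B z *\<^sub>R (e / 2))"
        using integrable_mult_indicator[OF Bs, of "\<lambda>z. e / 2"] by simp
    qed (use near in \<open>auto simp: indicator_def\<close>)
    also have "\<dots> = measure \<mu> B * (e / 2)"
      using Bs by (simp add: set_lebesgue_integral_def emeasure_eq_measure)
    finally have "\<bar>mean_value \<mu> B w - w x\<bar> \<le> e / 2" using m by simp
    then show "dist (mean_value \<mu> (rel_ball S x (s i)) w) (w x) < e"
      using e by (simp add: B_def dist_real_def)
  qed
qed

text \<open>Morrey's argument: the means of \<open>w\<close> over the balls of radius \<open>r / 2\<^sup>i\<close> around a point form a
  sequence with geometrically decreasing increments, because \<open>1 - Q/p > 0\<close>. The constant depends on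
  \<open>\<rho>\<close> only through the bound on its \<open>p\<close>-th moment.\<close>

lemma poincare_imp_hoelder:
  fixes S :: "'a::metric_space set"
  assumes D: "doubling_measure S \<mu> C\<^sub>d" and Q: "C\<^sub>d = 2 powr Q" "Q \<ge> 0"
    and S: "compact S" "S \<noteq> {}" and p: "p > 0" "p > Q"
    and P: "poincare_inequality S \<mu> p" and A: "A \<ge> 0"
  shows "\<exists>K>0. \<forall>w \<rho>. continuous_on S w \<longrightarrow> upper_gradient S w \<rho> \<longrightarrow>
    (\<integral>\<^sup>+ z. ennreal_powr (\<rho> z) p \<partial>\<mu>) \<le> ennreal A \<longrightarrow>
    (\<forall>x\<in>S. \<forall>y\<in>S. \<bar>w x - w y\<bar> \<le> K * dist x y powr (1 - Q / p))"
proof -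
  have fin: "finite_measure \<mu>" by (rule finite_doubling_measure[OF D compact_imp_bounded[OF S(1)] S(2)])
  interpret finite_measure \<mu> by (rule fin)
  obtain R0 where R0: "\<And>y z. y \<in> S \<Longrightarrow> z \<in> S \<Longrightarrow> dist y z \<le> R0"
    using compact_imp_bounded[OF S(1)] by (auto simp: bounded_two_points)
  have R0nn: "R0 \<ge> 0" using R0 S(2) zero_le_dist order.trans by (metis ex_in_conv)
  \<comment> \<open>The ball around \<open>x\<close> of radius \<open>2 * dist x y\<close> will be used, so twice the diameter is needed.\<close>
  define R where "R = 2 * R0 + 1"
  have R: "dist y z < R" if "y \<in> S" "z \<in> S" for y z using R0[OF that] R0nn by (simp add: R_def)
  obtain C \<Lambda> where C: "C > 0" and \<Lambda>: "\<Lambda> \<ge> 1"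
    and PI: "\<And>w \<rho> x r. w \<in> borel_measurable \<mu> \<Longrightarrow> upper_gradient S w \<rho> \<Longrightarrow> x \<in> S \<Longrightarrow> r > 0 \<Longrightarrow>
        set_integrable \<mu> (rel_ball S x r) w \<Longrightarrow>
        (\<integral>\<^sup>+ z \<in> rel_ball S x r. ennreal \<bar>w z - mean_value \<mu> (rel_ball S x r) w\<bar> \<partial>\<mu>)
            / emeasure \<mu> (rel_ball S x r)
          \<le> ennreal (C * diameter (rel_ball S x r)) *
             ennreal_powr
               ((\<integral>\<^sup>+ z \<in> rel_ball S x (\<Lambda> * r). ennreal_powr (\<rho> z) p \<partial>\<mu>)
                  / emeasure \<mu> (rel_ball S x (\<Lambda> * r))) (1 / p)"
    using P unfolding poincare_inequality_def by blast
  define \<alpha> where "\<alpha> = 1 - Q / p"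
  have \<alpha>: "\<alpha> > 0" using p by (simp add: \<alpha>_def)
  define \<theta> where "\<theta> = (1 / 2) powr \<alpha>"
  have \<theta>: "0 < \<theta>" "\<theta> < 1" using \<alpha> powr_less_mono2[of \<alpha> "1 / 2" 1] by (auto simp: \<theta>_def)
  define K0 where "K0 = 2 * C * (A * (2 * R) powr Q / measure \<mu> S) powr (1 / p)"
  have K0: "K0 \<ge> 0" using C by (simp add: K0_def)
  have C1: "C\<^sub>d \<ge> 1" using D by (simp add: doubling_measure_def)
  define K1 where "K1 = C\<^sub>d\<^sup>2 * K0"
  have K1: "K1 \<ge> 0" using K0 by (simp add: K1_def)
  \<comment> \<open>Two geometric series and one link between balls of radius at most \<open>2 * dist x y\<close>; adding 1
    makes the constant positive.\<close>
  define K where "K = K1 * 2 powr \<alpha> * (2 / (1 - \<theta>) + 1) + 1"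
  have "\<bar>w x - w y\<bar> \<le> K * dist x y powr \<alpha>"
    if w: "continuous_on S w" and ug: "upper_gradient S w \<rho>"
      and \<rho>: "(\<integral>\<^sup>+ z. ennreal_powr (\<rho> z) p \<partial>\<mu>) \<le> ennreal A" and xy: "x \<in> S" "y \<in> S" for w \<rho> x y
  proof -
    have "w \<in> borel_measurable (restrict_space borel S)" by (rule borel_measurable_continuous_on_restrict[OF w])
    moreover have sets: "sets \<mu> = sets (restrict_space borel S)" using D by (simp add: doubling_measure_def)
    ultimately have wm: "w \<in> borel_measurable \<mu>" using measurable_cong_sets[OF sets refl] by blast
    obtain M where M: "\<And>z. z \<in> S \<Longrightarrow> \<bar>w z\<bar> \<le> M"
      using compact_imp_bounded[OF compact_continuous_image[OF w S(1)]] by (auto simp: bounded_iff)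
    have wi: "integrable \<mu> w"
      by (rule integrable_const_bound[of _ M]) (use M wm doubling_measure_space[OF D] in auto)
    define m where "m z r = measure \<mu> (rel_ball S z r)" for z r
    define W where "W z r = mean_value \<mu> (rel_ball S z r) w" for z r
    have bs: "rel_ball S z r \<in> sets \<mu>" for z r by (rule doubling_measure_sets[OF D]) simp
    have osc: "(LINT u:rel_ball S z r|\<mu>. \<bar>w u - W z r\<bar>) \<le> K0 * r powr \<alpha> * m z r"
      if z: "z \<in> S" and r: "0 < r" "r \<le> R" for z r
      unfolding K0_def \<alpha>_def m_def W_def
    proof (rule mean_oscillation_le[OF D Q fin R p(1) A C \<Lambda> _ \<rho> wi z r])
      have "set_integrable \<mu> (rel_ball S z r) w"
        unfolding set_integrable_def by (rule integrable_mult_indicator[OF bs wi])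
      then show "(\<integral>\<^sup>+ u \<in> rel_ball S z r. ennreal \<bar>w u - mean_value \<mu> (rel_ball S z r) w\<bar> \<partial>\<mu>)
            / emeasure \<mu> (rel_ball S z r)
          \<le> ennreal (C * diameter (rel_ball S z r)) *
             ennreal_powr
               ((\<integral>\<^sup>+ u \<in> rel_ball S z (\<Lambda> * r). ennreal_powr (\<rho> u) p \<partial>\<mu>)
                  / emeasure \<mu> (rel_ball S z (\<Lambda> * r))) (1 / p)"
        by (rule PI[OF wm ug z r(1)])
    qed
    have link: "\<bar>W v s - W z r\<bar> \<le> K1 * r powr \<alpha>"
      if z: "z \<in> S" and r: "0 < r" "r \<le> R" and v: "v \<in> S" "s > 0"
        and sub: "rel_ball S v s \<subseteq> rel_ball S z r" and mm: "m z r \<le> C\<^sub>d\<^sup>2 * m v s" for v s z r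
    proof -
      have pos: "m v s > 0" unfolding m_def by (rule doubling_measure_measure(1)[OF D v])
      have "m v s * \<bar>W v s - W z r\<bar> \<le> (LINT u:rel_ball S z r|\<mu>. \<bar>w u - W z r\<bar>)"
        unfolding m_def W_def
        by (rule mean_value_diff_le[OF fin wi sub bs bs]) (use pos in \<open>simp add: m_def\<close>)
      also have "\<dots> \<le> K0 * r powr \<alpha> * m z r" by (rule osc[OF z r])
      also have "\<dots> \<le> K0 * r powr \<alpha> * (C\<^sub>d\<^sup>2 * m v s)" using K0 by (intro mult_left_mono mm) auto
      also have "\<dots> = m v s * (K1 * r powr \<alpha>)" by (simp add: K1_def)
      finally show ?thesis using pos by simp
    qed
    have dbl: "m z (2 * r) \<le> C\<^sub>d * m z r" if "z \<in> S" "r > 0" for z r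
      unfolding m_def by (rule doubling_measure_measure(3)[OF D that])
    have mnn: "m z r \<ge> 0" for z r by (simp add: m_def)
    have point: "\<bar>w z - W z r\<bar> \<le> K1 * r powr \<alpha> / (1 - \<theta>)" if z: "z \<in> S" and r: "0 < r" "r \<le> R" for z r
    proof -
      define s where "s i = r * (1 / 2) ^ i" for i
      have s: "s i > 0" "s i \<le> R" "s i = 2 * s (Suc i)" for i
      proof -
        show "s i > 0" using r by (simp add: s_def)
        have "s i \<le> r * 1" unfolding s_def using r by (intro mult_left_mono power_le_one) auto
        then show "s i \<le> R" using r by simp
        show "s i = 2 * s (Suc i)" by (simp add: s_def)
      qed
      have inc: "\<bar>W z (s (Suc i)) - W z (s i)\<bar> \<le> K1 * r powr \<alpha> * \<theta> ^ i" for i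
      proof -
        have "\<bar>W z (s (Suc i)) - W z (s i)\<bar> \<le> K1 * s i powr \<alpha>"
        proof (rule link[OF z s(1,2) z s(1)])
          show "rel_ball S z (s (Suc i)) \<subseteq> rel_ball S z (s i)" using s(1)[of "Suc i"] s(3)[of i] by auto
          have "m z (s i) \<le> C\<^sub>d * m z (s (Suc i))" using dbl[OF z s(1)[of "Suc i"]] s(3)[of i] by simp
          also have "\<dots> \<le> C\<^sub>d\<^sup>2 * m z (s (Suc i))"
            using C1 mnn by (intro mult_right_mono) (auto simp: power2_eq_square)
          finally show "m z (s i) \<le> C\<^sub>d\<^sup>2 * m z (s (Suc i))" .
        qed
        also have "s i powr \<alpha> = r powr \<alpha> * \<theta> ^ i"
        proof -
          have "((1 / 2) ^ i) powr \<alpha> = \<theta> ^ i"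
            unfolding \<theta>_def by (simp add: powr_powr mult.commute flip: powr_realpow)
          then show ?thesis using r by (simp add: s_def powr_mult)
        qed
        finally show ?thesis by (simp add: mult.assoc)
      qed
      have "\<bar>W z (s n) - W z r\<bar> \<le> K1 * r powr \<alpha> / (1 - \<theta>)" for n
      proof -
        have "W z (s n) - W z r = (\<Sum>i<n. W z (s (Suc i)) - W z (s i))"
          by (subst sum_lessThan_telescope) (simp add: s_def)
        then have "\<bar>W z (s n) - W z r\<bar> \<le> (\<Sum>i<n. K1 * r powr \<alpha> * \<theta> ^ i)"
          by (simp only:) (rule order.trans[OF sum_abs], intro sum_mono inc)
        also have "\<dots> = K1 * r powr \<alpha> * ((1 - \<theta> ^ n) / (1 - \<theta>))"
          using \<theta> by (simp add: sum_distrib_left[symmetric] sum_gp_strict)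
        also have "\<dots> \<le> K1 * r powr \<alpha> * (1 / (1 - \<theta>))"
          using K1 \<theta> by (intro mult_left_mono divide_right_mono) auto
        finally show ?thesis by simp
      qed
      moreover have "(\<lambda>n. W z (s n)) \<longlonglongrightarrow> w z"
        unfolding W_def
      proof (rule mean_value_tendsto[OF D fin w wi z])
        show "s \<longlonglongrightarrow> 0" unfolding s_def by (intro tendsto_mult_right_zero LIMSEQ_power_zero) simp
      qed (rule s(1))
      then have "(\<lambda>n. \<bar>W z (s n) - W z r\<bar>) \<longlonglongrightarrow> \<bar>w z - W z r\<bar>" by (intro tendsto_intros)
      ultimately show ?thesis by (intro LIMSEQ_le_const2) auto
    qed
    show ?thesis
    proof (cases "x = y")
      case False
      define r where "r = dist x y"
      have r: "r > 0" "2 * r \<le> R" "r \<le> R" using False R0[OF xy] R0nn by (auto simp: r_def R_def)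
      have "\<bar>w x - W x (2 * r)\<bar> \<le> K1 * (2 * r) powr \<alpha> / (1 - \<theta>)" by (rule point[OF xy(1)]) (use r in auto)
      moreover have "\<bar>W y r - W x (2 * r)\<bar> \<le> K1 * (2 * r) powr \<alpha>"
      proof (rule link[OF xy(1) _ _ xy(2)])
        show "rel_ball S y r \<subseteq> rel_ball S x (2 * r)"
        proof
          fix z assume "z \<in> rel_ball S y r"
          then show "z \<in> rel_ball S x (2 * r)" using dist_triangle[of x z y] by (auto simp: r_def)
        qed
        have "rel_ball S x (2 * r) \<subseteq> rel_ball S y (2 * (2 * r))"
        proof
          fix z assume "z \<in> rel_ball S x (2 * r)"
          then have z: "dist x z < 2 * r" "z \<in> S" by auto
          have "dist y x = r" by (simp add: r_def dist_commute)
          then have "dist y z < 2 * (2 * r)" using dist_triangle[of y z x] z(1) r(1) by linarith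
          then show "z \<in> rel_ball S y (2 * (2 * r))" using z(2) by simp
        qed
        then have "m x (2 * r) \<le> m y (2 * (2 * r))" unfolding m_def by (rule finite_measure_mono[OF _ bs])
        also have "\<dots> \<le> C\<^sub>d * m y (2 * r)" by (rule dbl) (use xy r in auto)
        also have "\<dots> \<le> C\<^sub>d * (C\<^sub>d * m y r)" using C1 by (intro mult_left_mono dbl) (use xy r in auto)
        finally show "m x (2 * r) \<le> C\<^sub>d\<^sup>2 * m y r" by (simp add: power2_eq_square mult.assoc)
      qed (use r in auto)
      moreover have "\<bar>w y - W y r\<bar> \<le> K1 * (2 * r) powr \<alpha> / (1 - \<theta>)"
      proof -
        have "\<bar>w y - W y r\<bar> \<le> K1 * r powr \<alpha> / (1 - \<theta>)" by (rule point[OF xy(2)]) (use r in auto)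
        also have "\<dots> \<le> K1 * (2 * r) powr \<alpha> / (1 - \<theta>)"
          using K1 \<theta> r \<alpha> by (intro divide_right_mono mult_left_mono powr_mono2) auto
        finally show ?thesis .
      qed
      ultimately have "\<bar>w x - w y\<bar> \<le> K1 * (2 * r) powr \<alpha> / (1 - \<theta>) + K1 * (2 * r) powr \<alpha> + K1 * (2 * r) powr \<alpha> / (1 - \<theta>)"
        by linarith
      also have "\<dots> = (K - 1) * r powr \<alpha>"
        using r by (simp add: K_def powr_mult algebra_simps add_divide_distrib)
      also have "\<dots> \<le> K * r powr \<alpha>" by (intro mult_right_mono) auto
      finally show ?thesis by (simp add: r_def)
    qed simp
  qed
  moreover have "K > 0" using K1 \<theta> by (auto simp: K_def intro!: add_nonneg_pos mult_nonneg_nonneg)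
  ultimately show ?thesis unfolding \<alpha>_def by blast
qed

section \<open>Cheap curves\<close>

text \<open>The chain cost from \<open>x\<close>, at every scale \<open>\<epsilon> n\<close>, has the Lipschitz majorant \<open>g n\<close> as upper
  gradient and vanishes at \<open>x\<close>, so it is at most \<open>K d(x, y)\<^bsup>1 - Q/p\<^esup>\<close> at \<open>y\<close> with \<open>K\<close>
  independent of \<open>n\<close>. The factor 2 leaves room for chains that do not attain the infimum.\<close>

theorem cheap_admissible_curves:
  fixes S :: "'a::metric_space set"
  assumes D: "doubling_measure S \<mu> C\<^sub>d" and Q: "C\<^sub>d = 2 powr Q" "Q \<ge> 0"
    and S: "compact S" "connected S" "S \<noteq> {}" and p: "p > 1" "p > Q"
    and P: "poincare_inequality S \<mu> p"
    and f: "integrable \<mu> (\<lambda>z. \<bar>f z\<bar> powr p)"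
  shows "\<exists>C>0. \<forall>x\<in>S. \<forall>y\<in>S. x \<noteq> y \<longrightarrow> (\<exists>l \<beta>. (l, \<beta>) \<in> admissible_curves S f x y \<and>
    line_integral 0 l \<beta> (\<lambda>z. ennreal (f z)) \<le> ennreal (C * dist x y powr (1 - Q / p)))"
proof -
  have fin: "finite_measure \<mu>" by (rule finite_doubling_measure[OF D compact_imp_bounded[OF S(1)] S(3)])
  have sets: "sets \<mu> = sets (restrict_space borel S)" using D by (simp add: doubling_measure_def)
  obtain g :: "nat \<Rightarrow> 'a \<Rightarrow> real" and L A where g: "\<And>n. (L n)-lipschitz_on S (g n)"
    "\<And>n z. 1 \<le> g n z" "\<And>n z. g n z \<le> 1 + real n" "\<And>m n z. m \<le> n \<Longrightarrow> g m z \<le> g n z"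
    "\<And>z. z \<in> S \<Longrightarrow> \<exists>n. f z \<le> g n z" "0 \<le> A"
    "\<And>n. (\<integral>\<^sup>+ z. ennreal_powr (ennreal (g n z)) p \<partial>\<mu>) \<le> ennreal A"
    using lipschitz_sequence_above_powr[OF fin sets p(1) f] by metis
  have gnn: "0 \<le> g n z" for n z using g(2)[of n z] by simp
  have "p > 0" using p(1) by simp
  from poincare_imp_hoelder[OF D Q S(1,3) this p(2) P g(6)]
  obtain K where K: "K > 0" and hoelder: "\<And>w \<rho> x y. continuous_on S w \<Longrightarrow> upper_gradient S w \<rho> \<Longrightarrow>
    (\<integral>\<^sup>+ z. ennreal_powr (\<rho> z) p \<partial>\<mu>) \<le> ennreal A \<Longrightarrow> x \<in> S \<Longrightarrow> y \<in> S \<Longrightarrow>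
    \<bar>w x - w y\<bar> \<le> K * dist x y powr (1 - Q / p)"
    by blast
  \<comment> \<open>As \<open>g n\<close> is at most \<open>n + 1\<close>, a step of length \<open>\<epsilon> n\<close> costs at most \<open>1 / (n + 1)\<close>.\<close>
  define \<epsilon> where "\<epsilon> n = inverse (real (Suc n) * real (Suc n))" for n
  have \<epsilon>: "\<epsilon> n > 0" for n by (simp add: \<epsilon>_def)
  have g\<epsilon>: "g n z * \<epsilon> n \<le> inverse (real (Suc n))" for n z
  proof -
    have "g n z * \<epsilon> n \<le> real (Suc n) * \<epsilon> n" using g(3)[of n z] \<epsilon>[of n] by (intro mult_right_mono) auto
    also have "\<dots> = inverse (real (Suc n))" by (simp add: \<epsilon>_def del: of_nat_Suc)
    finally show ?thesis .
  qed
  have "\<exists>l \<beta>. (l, \<beta>) \<in> admissible_curves S f x y \<and>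
    line_integral 0 l \<beta> (\<lambda>z. ennreal (f z)) \<le> ennreal (2 * K * dist x y powr (1 - Q / p))"
    if xy: "x \<in> S" "y \<in> S" "x \<noteq> y" for x y
  proof -
    define T where "T = 2 * K * dist x y powr (1 - Q / p)"
    have "0 < dist x y powr (1 - Q / p)" using xy(3) by simp
    then have T: "0 < T" "K * dist x y powr (1 - Q / p) < T" using K by (auto simp: T_def)
    have "\<exists>v\<in>chain_costs S (g n) (\<epsilon> n) x y. v \<le> T" for n
    proof -
      define w where "w z = Inf (chain_costs S (g n) (\<epsilon> n) x z)" for z
      have "continuous_on S w"
        unfolding w_def by (rule continuous_on_Inf_chain_costs[OF S(2) xy(1) \<epsilon> gnn g(3)])
      moreover have "upper_gradient S w (\<lambda>z. ennreal (g n z))"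
      proof (rule upper_gradient_of_small_scale_growth[OF g(1) gnn \<epsilon>])
        show "w z - w y \<le> g n y * dist y z" if "y \<in> S" "z \<in> S" "dist y z \<le> \<epsilon> n" for y z
          unfolding w_def by (rule Inf_chain_costs_step[OF S(2) xy(1) that(1,2) \<epsilon> that(3) gnn])
      qed
      ultimately have "\<bar>w x - w y\<bar> \<le> K * dist x y powr (1 - Q / p)"
        by (rule hoelder[OF _ _ g(7) xy(1,2)])
      moreover have "w x = 0" unfolding w_def by (rule Inf_chain_costs_self[OF xy(1) gnn])
      ultimately have "w y < T" using T(2) by simp
      then obtain v where "v \<in> chain_costs S (g n) (\<epsilon> n) x y" "v < T"
        unfolding w_def using cInf_lessD[OF chain_costs_nonempty[OF S(2) xy(1,2) \<epsilon>]] by blast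
      then show ?thesis by (meson less_imp_le)
    qed
    from slow_curve_of_chains[OF S(1) g(1) g(2) g(4) g\<epsilon> this] obtain \<gamma>
      where \<gamma>: "\<gamma> 0 = x" "\<gamma> T = y" "range \<gamma> \<subseteq> S"
        and slow: "\<And>s t. 0 \<le> s \<Longrightarrow> s \<le> t \<Longrightarrow> dist (\<gamma> s) (\<gamma> t) \<le> t - s"
          "\<And>s t m. 0 \<le> s \<Longrightarrow> s \<le> t \<Longrightarrow> (g m (\<gamma> s) - L m * (t - s)) * dist (\<gamma> s) (\<gamma> t) \<le> t - s"
      by blast
    have "\<exists>l \<beta>. (l, \<beta>) \<in> admissible_curves S f (\<gamma> 0) (\<gamma> T) \<and>
      line_integral 0 l \<beta> (\<lambda>z. ennreal (f z)) \<le> ennreal T"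
      by (rule admissible_curve_of_slow_curve[where g = g and L = L])
        (use T(1) \<gamma>(3) slow g gnn in auto)
    then show ?thesis unfolding \<gamma>(1,2) unfolding T_def .
  qed
  then show ?thesis using K by (intro exI[of _ "2 * K"]) auto
qed

lemma constant_curve_admissible:
  assumes "x \<in> S"
  shows "(0, \<lambda>_. x) \<in> admissible_curves S f x x"
    and "line_integral 0 0 (\<lambda>_. x) \<rho> = 0"
proof -
  have len: "curve_length 0 0 (\<lambda>_. x) = 0"
    using curve_length_le[of 0 0 "\<lambda>_. x" "\<lambda>_. 0"] by simp
  have *: "line_integral 0 0 (\<lambda>_. x) \<rho> = 0" for \<rho>
  proof -
    have "line_integral 0 0 (\<lambda>_. x) \<rho> = (\<integral>\<^sup>+ s \<in> {0}. \<rho> x \<partial>lborel)"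
      by (simp add: line_integral_def len arc_length_reparam_def)
    then show ?thesis by (simp add: nn_integral_cmult_indicator)
  qed
  then show "line_integral 0 0 (\<lambda>_. x) \<rho> = 0" .
  show "(0, \<lambda>_. x) \<in> admissible_curves S f x x"
    using assms * len by (simp add: admissible_curves_def rectifiable_curve_def arc_length_parametrized_def)
qed

theorem proposition5p2:
  fixes \<Omega> :: "'a::complete_space set"
    and \<mu> :: "'a measure"
    and f :: "'a \<Rightarrow> real"
    and C\<^sub>d Q p :: real
  assumes "length_space (UNIV :: 'a set)"
    and "open \<Omega>" and "connected \<Omega>" and "\<Omega> \<noteq> {}" and "bounded \<Omega>" and "\<Omega> \<noteq> UNIV"
    and "doubling_measure (closure \<Omega>) \<mu> C\<^sub>d"
    and "Q = homogeneous_dimension C\<^sub>d" and "Q > 0"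
    and "f \<in> borel_measurable (restrict_space borel (closure \<Omega>))"
    and "\<forall>z\<in>closure \<Omega>. f z > 0"
    and "p > max 1 Q"
    and "poincare_inequality (closure \<Omega>) \<mu> p"
    and "integrable \<mu> (\<lambda>z. \<bar>f z\<bar> powr p)"
  shows "(\<forall>x\<in>closure \<Omega>. \<forall>y\<in>closure \<Omega>. x \<noteq> y \<longrightarrow>
            (\<exists>l \<gamma>. (l, \<gamma>) \<in> admissible_curves (closure \<Omega>) f x y)) \<and>
         (\<forall>x\<in>closure \<Omega>. \<forall>y\<in>closure \<Omega>. admissible_curves (closure \<Omega>) f x y \<noteq> {}) \<and>
         (\<exists>C\<^sub>f>0. \<forall>x\<in>closure \<Omega>. \<forall>y\<in>closure \<Omega>.
            L_dist (closure \<Omega>) f x y \<le> ennreal (C\<^sub>f * dist x y powr (1 - Q / p))) \<and>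
         ((\<lambda>r. SUP (x, y) \<in> {(x, y). x \<in> closure \<Omega> \<and> y \<in> closure \<Omega> \<and> dist x y \<le> r}.
             L_dist (closure \<Omega>) f x y) \<longlongrightarrow> 0) (at_right 0)"
proof -
  define S where "S = closure \<Omega>"
  note D = assms(7)[folded S_def]
  have "C\<^sub>d \<ge> 1" using D by (simp add: doubling_measure_def)
  then have Q: "C\<^sub>d = 2 powr Q" "Q \<ge> 0"
    using assms(8,9) by (simp_all add: homogeneous_dimension_def)
  have p: "p > 1" "p > Q" using assms(12) by auto
  have S: "compact S" "connected S" "S \<noteq> {}"
  proof -
    show ne: "S \<noteq> {}" using assms(4) by (simp add: S_def)
    show "connected S" unfolding S_def using assms(3) by (rule connected_imp_connected_closure)
    show "compact S"
      by (rule compact_if_doubling_measure[OF D Q _ _ ne]) (use assms(5) in \<open>auto simp: S_def\<close>)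
  qed
  obtain C where C: "C > 0" and cheap: "\<And>x y. x \<in> S \<Longrightarrow> y \<in> S \<Longrightarrow> x \<noteq> y \<Longrightarrow>
    \<exists>l \<beta>. (l, \<beta>) \<in> admissible_curves S f x y \<and>
      line_integral 0 l \<beta> (\<lambda>z. ennreal (f z)) \<le> ennreal (C * dist x y powr (1 - Q / p))"
    using cheap_admissible_curves[OF D Q S p assms(13,14)[folded S_def]] by blast
  have all: "\<exists>l \<beta>. (l, \<beta>) \<in> admissible_curves S f x y \<and>
      line_integral 0 l \<beta> (\<lambda>z. ennreal (f z)) \<le> ennreal (C * dist x y powr (1 - Q / p))"
    if "x \<in> S" "y \<in> S" for x y
  proof (cases "x = y")
    case True
    then show ?thesis using constant_curve_admissible[OF that(1)] by (intro exI[of _ 0] exI[of _ "\<lambda>_. x"]) auto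
  qed (use cheap that in blast)
  have L: "L_dist S f x y \<le> ennreal (C * dist x y powr (1 - Q / p))" if xy: "x \<in> S" "y \<in> S" for x y
  proof -
    obtain l \<beta> where l\<beta>: "(l, \<beta>) \<in> admissible_curves S f x y"
      "line_integral 0 l \<beta> (\<lambda>z. ennreal (f z)) \<le> ennreal (C * dist x y powr (1 - Q / p))"
      using all[OF xy] by blast
    then show ?thesis unfolding L_dist_def by (intro INF_lower2[OF l\<beta>(1)]) auto
  qed
  have \<alpha>: "1 - Q / p > 0" using p by simp
  have "((\<lambda>r. SUP (x, y) \<in> {(x, y). x \<in> S \<and> y \<in> S \<and> dist x y \<le> r}. L_dist S f x y) \<longlongrightarrow> 0) (at_right 0)"
  proof (rule tendsto_sandwich[OF _ _ tendsto_const])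
    show "\<forall>\<^sub>F r in at_right 0. (SUP (x, y) \<in> {(x, y). x \<in> S \<and> y \<in> S \<and> dist x y \<le> r}. L_dist S f x y)
        \<le> ennreal (C * r powr (1 - Q / p))"
    proof (rule always_eventually, intro allI SUP_least, clarify)
      fix r x y assume xy: "x \<in> S" "y \<in> S" "dist x y \<le> r"
      have "C * dist x y powr (1 - Q / p) \<le> C * r powr (1 - Q / p)"
        using xy C \<alpha> by (intro mult_left_mono powr_mono2) auto
      then show "L_dist S f x y \<le> ennreal (C * r powr (1 - Q / p))"
        using L[OF xy(1,2)] by (meson ennreal_leI order.trans)
    qed
    have "((\<lambda>r::real. r powr (1 - Q / p)) \<longlongrightarrow> 0 powr (1 - Q / p)) (at_right 0)"
      using \<alpha> by (intro tendsto_powr' tendsto_intros) (auto simp: eventually_at_filter)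
    then have "((\<lambda>r. ennreal (C * r powr (1 - Q / p))) \<longlongrightarrow> ennreal (C * 0)) (at_right 0)"
      by (intro tendsto_intros) auto
    then show "((\<lambda>r. ennreal (C * r powr (1 - Q / p))) \<longlongrightarrow> 0) (at_right 0)" by simp
  qed auto
  then show ?thesis
    unfolding S_def[symmetric] using all L C by blast
qed

end
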